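(* Let $\varphi$ be an action of a group $G$ on $\mathbb{R}^d$ by smooth diffeomorphisms. Then the Maurer–Cartan elements $a$ in the DGA $\mathcal{P}_\varphi^\bullet$ of formal $G$-amplitudes (normalized by $a_e=1$, $e$ the unit of $G$) are in one-to-one correspondence with the formal $G$-systems associated with $\varphi$, the correspondence being $a\mapsto a$ with associated operators $T_g^a=\mathrm{Op}_1(a_g,\varphi_g)$. Moreover, gauge equivalent Maurer–Cartan elements yield equivalent representations.
   Context: An action is a family of diffeomorphisms $\varphi_g$ of $\mathbb{R}^d$, $g\in G$, with $\varphi_{gh}=\varphi_g\circ\varphi_h$ and $\varphi_e=\mathrm{id}$. $G$ is any group, and functions are complex valued. $\mathcal{P}$ is the space of formal symbols $P(x,\xi)=\sum_{n\ge0}\hbar^n\sum_{|\alpha|\le n}f_{n,\alpha}(x)\xi^\alpha$ with $f_{n,\alpha}\in C^\infty(\mathbb{R}^d)$. With $D^\alpha=i^{-|\alpha|}\partial_x^\alpha$, a pair $P\in\mathcal{P}$, $\phi\in\mathrm{Diff}(\mathbb{R}^d)$ defines the $\mathbb{C}[[\hbar]]$-linear operator on $C^\infty(\mathbb{R}^d)[[\hbar]]$ $$\mathrm{Op}_1(P,\phi)\psi(x)=\sum_{n\ge0}\hbar^n\sum_{|\alpha|\le n}f_{n,\alpha}(x)\,(D^\alpha\psi)(\phi^{-1}(x)).$$ For $P,K\in\mathcal{P}$ and diffeomorphisms $\phi_1,\phi_2$, the symbol $P\,{}_{\phi_1}\star_{\phi_2}K\in\mathcal{P}$ is determined by $\mathrm{Op}_1(P,\phi_1)\circ\mathrm{Op}_1(K,\phi_2)=\mathrm{Op}_1(P\,{}_{\phi_1}\star_{\phi_2}K,\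 \phi_1\circ\phi_2)$. $\mathcal{P}_\varphi^k$ is the space of all maps $a:G^k\to\mathcal{P}$ ($\mathcal{P}_\varphi^0=\mathcal{P}$), with differential $(da)_{g_1,\dots,g_{k+1}}=\sum_{i=1}^k(-1)^ia_{g_1,\dots,g_ig_{i+1},\dots,g_{k+1}}$ (zero for $k=0$) and product $(a\star b)_{g_1,\dots,g_{k+l}}=a_{g_1,\dots,g_k}\;{}_{\varphi_{g_1\cdots g_k}}\star_{\varphi_{g_{k+1}\cdots g_{k+l}}}\;b_{g_{k+1},\dots,g_{k+l}}$ for $a\in\mathcal{P}_\varphi^k$, $b\in\mathcal{P}_\varphi^l$ (the empty product of group elements is $e$). A Maurer–Cartan element is $a\in\mathcal{P}_\varphi^1$ with $da+a\star a=0$. Two Maurer–Cartan elements $a,b$ are gauge equivalent if there is an invertible $u\in\mathcal{P}_\varphi^0$ with $a\star u-u\star b=du$. A formal $G$-system associated with $\varphi$ is a map $a:G\to\mathcal{P}$ such that the operators $T_g^a=\mathrm{Op}_1(a_g,\varphi_g)$ form a representation of $G$ on $C^\infty(\mathbb{R}^d)[[\hbar]]$. Two representations $T,T'$ are equivalent if $T_g\circ U=U\circ T'_g$ for all $g$, for some invertible $\mathbb{C}[[\hbar]]$-linear operator $U$. *)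

theory Defs
  imports
    "HOL-Analysis.Analysis"
    "HOL-Algebra.Group"
    "HOL-Computational_Algebra.Formal_Power_Series"
    "HOL-Library.Function_Algebras"
begin

section \<open>Smooth functions and diffeomorphisms\<close>

primrec is_Ck ::
  "nat \<Rightarrow> ('a::euclidean_space \<Rightarrow> 'b::real_normed_vector) \<Rightarrow> bool" where
  "is_Ck 0 f \<longleftrightarrow> continuous_on UNIV f"
| "is_Ck (Suc k) f \<longleftrightarrow>
     (\<forall>x. f differentiable (at x)) \<and>
     (\<forall>v. is_Ck k (\<lambda>x. frechet_derivative f (at x) v))"

definition smooth :: "('a::euclidean_space \<Rightarrow> 'b::real_normed_vector) \<Rightarrow> bool" where
  "smooth f \<longleftrightarrow> (\<forall>k. is_Ck k f)"

definition diffeomorphism :: "('a::euclidean_space \<Rightarrow> 'a) \<Rightarrow> bool" where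
  "diffeomorphism \<phi> \<longleftrightarrow> bij \<phi> \<and> smooth \<phi> \<and> smooth (inv_into UNIV \<phi>)"

definition smooth_action ::
  "('g, 'm) monoid_scheme \<Rightarrow> ('g \<Rightarrow> 'a::euclidean_space \<Rightarrow> 'a) \<Rightarrow> bool" where
  "smooth_action G \<phi> \<longleftrightarrow>
     (\<forall>g\<in>carrier G. diffeomorphism (\<phi> g)) \<and>
     (\<forall>g\<in>carrier G. \<forall>h\<in>carrier G. \<phi> (g \<otimes>\<^bsub>G\<^esub> h) = \<phi> g \<circ> \<phi> h) \<and>
     \<phi> \<one>\<^bsub>G\<^esub> = id"

section \<open>Multi-indices and the derivatives $D^\alpha$\<close>

text \<open>A multi-index is a function \<open>'d \<Rightarrow> nat\<close> on the finite type of coordinates.\<close>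

definition mi_abs :: "('d::finite \<Rightarrow> nat) \<Rightarrow> nat" where
  "mi_abs \<alpha> = (\<Sum>i\<in>UNIV. \<alpha> i)"

lemma finite_mi_abs_le: "finite {\<alpha> :: 'd::finite \<Rightarrow> nat. mi_abs \<alpha> \<le> n}"
proof (rule finite_subset)
  show "{\<alpha> :: 'd \<Rightarrow> nat. mi_abs \<alpha> \<le> n} \<subseteq> (UNIV \<rightarrow>\<^sub>E {..n})"
  proof
    fix \<alpha> :: "'d \<Rightarrow> nat" assume "\<alpha> \<in> {\<alpha>. mi_abs \<alpha> \<le> n}"
    moreover have "\<alpha> i \<le> mi_abs \<alpha>" for i
      unfolding mi_abs_def by (rule member_le_sum) auto
    ultimately show "\<alpha> \<in> UNIV \<rightarrow>\<^sub>E {..n}" by (auto intro: order_trans)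
  qed
qed (simp add: finite_PiE)

definition partial_deriv ::
  "'d::finite \<Rightarrow> (real^'d \<Rightarrow> complex) \<Rightarrow> real^'d \<Rightarrow> complex" where
  "partial_deriv i f = (\<lambda>x. frechet_derivative f (at x) (axis i 1))"

text \<open>
  The coordinate type carries no order, so the partial derivatives are taken along an
  arbitrarily chosen enumeration of the coordinates. On smooth functions, the only ones to
  which they are applied, partial derivatives commute and the choice is irrelevant.
\<close>

definition coords :: "'d::finite list" where
  "coords = (SOME is. distinct is \<and> set is = UNIV)"

definition multi_deriv ::
  "('d::finite \<Rightarrow> nat) \<Rightarrow> (real^'d \<Rightarrow> complex) \<Rightarrow> real^'d \<Rightarrow> complex" where
  "multi_deriv \<alpha> f = foldr (\<lambda>i. partial_deriv i ^^ \<alpha> i) coords f"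

definition multi_D ::
  "('d::finite \<Rightarrow> nat) \<Rightarrow> (real^'d \<Rightarrow> complex) \<Rightarrow> real^'d \<Rightarrow> complex" where
  "multi_D \<alpha> f = (\<lambda>x. multi_deriv \<alpha> f x / \<i> ^ mi_abs \<alpha>)"

section \<open>The $\mathbb{C}[[\hbar]]$-module $C^\infty(\mathbb{R}^d)[[\hbar]]$\<close>

definition smooth_series :: "(real^'d::finite \<Rightarrow> complex) fps set" where
  "smooth_series = {\<psi>. \<forall>n. smooth (fps_nth \<psi> n)}"

definition series_scale ::
  "complex fps \<Rightarrow> (real^'d::finite \<Rightarrow> complex) fps \<Rightarrow> (real^'d \<Rightarrow> complex) fps" where
  "series_scale c \<psi> = Abs_fps (\<lambda>n x. \<Sum>k\<le>n. fps_nth c k * fps_nth \<psi> (n - k) x)"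

text \<open>
  Operators are total functions of which only the values on \<open>smooth_series\<close> matter; all
  identities between operators below are restricted to that set.
\<close>

definition series_linear ::
  "((real^'d::finite \<Rightarrow> complex) fps \<Rightarrow> (real^'d \<Rightarrow> complex) fps) \<Rightarrow> bool" where
  "series_linear U \<longleftrightarrow>
     (\<forall>\<psi>\<in>smooth_series. U \<psi> \<in> smooth_series) \<and>
     (\<forall>\<psi>\<in>smooth_series. \<forall>\<psi>'\<in>smooth_series. U (\<psi> + \<psi>') = U \<psi> + U \<psi>') \<and>
     (\<forall>c. \<forall>\<psi>\<in>smooth_series. U (series_scale c \<psi>) = series_scale c (U \<psi>))"

definition series_invertible ::
  "((real^'d::finite \<Rightarrow> complex) fps \<Rightarrow> (real^'d \<Rightarrow> complex) fps) \<Rightarrow> bool" where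
  "series_invertible U \<longleftrightarrow>
     series_linear U \<and>
     (\<exists>V. series_linear V \<and> (\<forall>\<psi>\<in>smooth_series. V (U \<psi>) = \<psi> \<and> U (V \<psi>) = \<psi>))"

section \<open>Formal symbols and their operators\<close>

text \<open>\<open>P n \<alpha>\<close> is the coefficient function $f_{n,\alpha}$ of $\hbar^n \xi^\alpha$.\<close>

type_synonym 'd symbol = "nat \<Rightarrow> ('d \<Rightarrow> nat) \<Rightarrow> real^'d \<Rightarrow> complex"

definition symbols :: "'d::finite symbol set" where
  "symbols = {P. (\<forall>n \<alpha>. smooth (P n \<alpha>)) \<and> (\<forall>n \<alpha>. n < mi_abs \<alpha> \<longrightarrow> P n \<alpha> = (\<lambda>x. 0))}"

definition symbol_one :: "'d::finite symbol" where
  "symbol_one = (\<lambda>n \<alpha> x. if n = 0 \<and> \<alpha> = (\<lambda>i. 0) then 1 else 0)"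

definition Op1 ::
  "'d::finite symbol \<Rightarrow> (real^'d \<Rightarrow> real^'d) \<Rightarrow>
     (real^'d \<Rightarrow> complex) fps \<Rightarrow> (real^'d \<Rightarrow> complex) fps" where
  "Op1 P \<phi> \<psi> = Abs_fps (\<lambda>N x.
     \<Sum>n\<le>N. \<Sum>\<alpha> | mi_abs \<alpha> \<le> n.
       P n \<alpha> x * multi_D \<alpha> (fps_nth \<psi> (N - n)) (inv_into UNIV \<phi> x))"

definition symbol_star ::
  "(real^'d::finite \<Rightarrow> real^'d) \<Rightarrow> (real^'d \<Rightarrow> real^'d) \<Rightarrow>
     'd symbol \<Rightarrow> 'd symbol \<Rightarrow> 'd symbol" where
  "symbol_star \<phi>\<^sub>1 \<phi>\<^sub>2 P K =
     (THE S. S \<in> symbols \<and>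
        (\<forall>\<psi>\<in>smooth_series. Op1 P \<phi>\<^sub>1 (Op1 K \<phi>\<^sub>2 \<psi>) = Op1 S (\<phi>\<^sub>1 \<circ> \<phi>\<^sub>2) \<psi>))"

section \<open>The DGA of formal amplitudes\<close>

text \<open>
  Elements of $G^k$ are lists of length \<open>k\<close>. Cochains are extensional functions on them.
\<close>

definition tuples :: "('g, 'm) monoid_scheme \<Rightarrow> nat \<Rightarrow> 'g list set" where
  "tuples G k = {gs. length gs = k \<and> set gs \<subseteq> carrier G}"

definition cochains :: "('g, 'm) monoid_scheme \<Rightarrow> nat \<Rightarrow> ('g list \<Rightarrow> 'd::finite symbol) set" where
  "cochains G k = tuples G k \<rightarrow>\<^sub>E symbols"

definition list_mult :: "('g, 'm) monoid_scheme \<Rightarrow> 'g list \<Rightarrow> 'g" where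
  "list_mult G gs = foldr (\<lambda>g h. g \<otimes>\<^bsub>G\<^esub> h) gs \<one>\<^bsub>G\<^esub>"

text \<open>
  The index \<open>i\<close> counts from 1, list positions count from 0.
\<close>

definition merge_at :: "('g, 'm) monoid_scheme \<Rightarrow> nat \<Rightarrow> 'g list \<Rightarrow> 'g list" where
  "merge_at G i gs = take (i - 1) gs @ (gs ! (i - 1) \<otimes>\<^bsub>G\<^esub> gs ! i) # drop (i + 1) gs"

definition cochain_d ::
  "('g, 'm) monoid_scheme \<Rightarrow> nat \<Rightarrow> ('g list \<Rightarrow> 'd::finite symbol) \<Rightarrow> 'g list \<Rightarrow> 'd symbol" where
  "cochain_d G k a =
     (\<lambda>gs\<in>tuples G (Suc k). \<lambda>n \<alpha> x. \<Sum>i=1..k. (-1) ^ i * a (merge_at G i gs) n \<alpha> x)"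

definition cochain_star ::
  "('g, 'm) monoid_scheme \<Rightarrow> ('g \<Rightarrow> real^'d::finite \<Rightarrow> real^'d) \<Rightarrow> nat \<Rightarrow> nat \<Rightarrow>
     ('g list \<Rightarrow> 'd symbol) \<Rightarrow> ('g list \<Rightarrow> 'd symbol) \<Rightarrow> 'g list \<Rightarrow> 'd symbol" where
  "cochain_star G \<phi> k l a b =
     (\<lambda>gs\<in>tuples G (k + l).
        symbol_star (\<phi> (list_mult G (take k gs))) (\<phi> (list_mult G (drop k gs)))
          (a (take k gs)) (b (drop k gs)))"

definition cochain_one :: "('g, 'm) monoid_scheme \<Rightarrow> 'g list \<Rightarrow> 'd::finite symbol" where
  "cochain_one G = (\<lambda>gs\<in>tuples G 0. symbol_one)"

definition maurer_cartan ::
  "('g, 'm) monoid_scheme \<Rightarrow> ('g \<Rightarrow> real^'d::finite \<Rightarrow> real^'d) \<Rightarrow>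
     ('g list \<Rightarrow> 'd symbol) set" where
  "maurer_cartan G \<phi> =
     {a \<in> cochains G 1.
        \<forall>gs\<in>tuples G 2. cochain_d G 1 a gs + cochain_star G \<phi> 1 1 a a gs = 0}"

definition normalized_maurer_cartan ::
  "('g, 'm) monoid_scheme \<Rightarrow> ('g \<Rightarrow> real^'d::finite \<Rightarrow> real^'d) \<Rightarrow>
     ('g list \<Rightarrow> 'd symbol) set" where
  "normalized_maurer_cartan G \<phi> = {a \<in> maurer_cartan G \<phi>. a [\<one>\<^bsub>G\<^esub>] = symbol_one}"

definition cochain_invertible ::
  "('g, 'm) monoid_scheme \<Rightarrow> ('g \<Rightarrow> real^'d::finite \<Rightarrow> real^'d) \<Rightarrow>
     ('g list \<Rightarrow> 'd symbol) \<Rightarrow> bool" where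
  "cochain_invertible G \<phi> u \<longleftrightarrow>
     u \<in> cochains G 0 \<and>
     (\<exists>v\<in>cochains G 0.
        cochain_star G \<phi> 0 0 u v = cochain_one G \<and> cochain_star G \<phi> 0 0 v u = cochain_one G)"

definition gauge_equivalent ::
  "('g, 'm) monoid_scheme \<Rightarrow> ('g \<Rightarrow> real^'d::finite \<Rightarrow> real^'d) \<Rightarrow>
     ('g list \<Rightarrow> 'd symbol) \<Rightarrow> ('g list \<Rightarrow> 'd symbol) \<Rightarrow> bool" where
  "gauge_equivalent G \<phi> a b \<longleftrightarrow>
     (\<exists>u. cochain_invertible G \<phi> u \<and>
        (\<forall>gs\<in>tuples G 1.
           cochain_star G \<phi> 1 0 a u gs - cochain_star G \<phi> 0 1 u b gs = cochain_d G 0 u gs))"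

section \<open>Representations and formal $G$-systems\<close>

definition representation ::
  "('g, 'm) monoid_scheme \<Rightarrow>
     ('g \<Rightarrow> (real^'d::finite \<Rightarrow> complex) fps \<Rightarrow> (real^'d \<Rightarrow> complex) fps) \<Rightarrow> bool" where
  "representation G T \<longleftrightarrow>
     (\<forall>g\<in>carrier G. series_linear (T g)) \<and>
     (\<forall>g\<in>carrier G. \<forall>h\<in>carrier G. \<forall>\<psi>\<in>smooth_series. T (g \<otimes>\<^bsub>G\<^esub> h) \<psi> = T g (T h \<psi>)) \<and>
     (\<forall>\<psi>\<in>smooth_series. T \<one>\<^bsub>G\<^esub> \<psi> = \<psi>)"

definition equivalent_representations ::
  "('g, 'm) monoid_scheme \<Rightarrow>
     ('g \<Rightarrow> (real^'d::finite \<Rightarrow> complex) fps \<Rightarrow> (real^'d \<Rightarrow> complex) fps) \<Rightarrow>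
     ('g \<Rightarrow> (real^'d \<Rightarrow> complex) fps \<Rightarrow> (real^'d \<Rightarrow> complex) fps) \<Rightarrow> bool" where
  "equivalent_representations G T T' \<longleftrightarrow>
     representation G T \<and> representation G T' \<and>
     (\<exists>U. series_invertible U \<and>
        (\<forall>g\<in>carrier G. \<forall>\<psi>\<in>smooth_series. T g (U \<psi>) = U (T' g \<psi>)))"

definition system_op ::
  "('g \<Rightarrow> real^'d::finite \<Rightarrow> real^'d) \<Rightarrow> ('g \<Rightarrow> 'd symbol) \<Rightarrow>
     'g \<Rightarrow> (real^'d \<Rightarrow> complex) fps \<Rightarrow> (real^'d \<Rightarrow> complex) fps" where
  "system_op \<phi> a g = Op1 (a g) (\<phi> g)"

definition formal_systems ::
  "('g, 'm) monoid_scheme \<Rightarrow> ('g \<Rightarrow> real^'d::finite \<Rightarrow> real^'d) \<Rightarrow> ('g \<Rightarrow> 'd symbol) set" where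
  "formal_systems G \<phi> = {a \<in> carrier G \<rightarrow>\<^sub>E symbols. representation G (system_op \<phi> a)}"

text \<open>The identification of $\mathcal{P}^1_\varphi$ with the maps $G \to \mathcal{P}$.\<close>

definition system_of ::
  "('g, 'm) monoid_scheme \<Rightarrow> ('g list \<Rightarrow> 'd::finite symbol) \<Rightarrow> 'g \<Rightarrow> 'd symbol" where
  "system_of G a = (\<lambda>g\<in>carrier G. a [g])"

end

theory Submission
  imports Defs
begin

text \<open>
  A symbol is determined by its operator, as one sees by applying the operator to the monomials
  \<open>(x - y)\<^sup>\<alpha>\<close> and evaluating at a point over \<open>y\<close>. Conversely, by the chain rule, the Leibniz
  rule and the symmetry of second derivatives, differentiating an operator
  \<open>f \<mapsto> (\<Sum>\<^bsub>|\<alpha>| \<le> n\<^esub> c\<^sub>\<alpha> (D\<^sup>\<alpha> f) \<circ> \<theta>)\<close> once gives an operator of the same form with \<open>n + 1\<close> in place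
  of \<open>n\<close>. The coefficient of \<open>h\<^sup>k\<close> in a composition of two operators \<open>Op1\<close> therefore has order at most
  \<open>k\<close>, so the star product exists and is unique. Hence \<open>da + a \<star> a = 0\<close>, which reads
  \<open>a\<^bsub>gh\<^esub> = a\<^sub>g \<star> a\<^sub>h\<close>, is multiplicativity of \<open>T\<^sup>a\<close>, and \<open>a\<^sub>e = 1\<close> is \<open>T\<^sup>a\<^sub>e = id\<close>. As \<open>d\<close> vanishes on
  \<open>0\<close>-cochains, a gauge equivalence \<open>u\<close> gives the intertwiner \<open>Op1 u id\<close>.
\<close>

section \<open>Calculus of smooth functions\<close>

lemma is_Ck_Suc_imp: "is_Ck (Suc k) f \<Longrightarrow> is_Ck k f"
proof (induction k arbitrary: f)
  case 0
  then show ?case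
    by (simp add: differentiable_imp_continuous_within continuous_at_imp_continuous_on)
next
  case (Suc k)
  then show ?case by simp
qed

lemma is_Ck_differentiable: "is_Ck (Suc k) f \<Longrightarrow> f differentiable (at x)"
  by simp

lemma is_Ck_has_derivative:
  "is_Ck (Suc k) f \<Longrightarrow> (f has_derivative frechet_derivative f (at x)) (at x)"
  using frechet_derivative_works by (simp only: is_Ck.simps) blast

lemma is_Ck_frechet_derivative: "is_Ck (Suc k) f \<Longrightarrow> is_Ck k (\<lambda>x. frechet_derivative f (at x) v)"
  by simp

text \<open>Derivatives are unique, so \<open>f'\<close> coincides with
  \<open>frechet_derivative f\<close>. This lets regularity be read off from an explicit derivative
  formula, as in all the closure proofs below.\<close>

lemma is_Ck_SucI:
  assumes "\<And>x. (f has_derivative f' x) (at x)" "\<And>v. is_Ck k (\<lambda>x. f' x v)"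
  shows "is_Ck (Suc k) f"
proof -
  have "f' = (\<lambda>x. frechet_derivative f (at x))"
    using assms(1) frechet_derivative_at by blast
  then show ?thesis
    using assms by (auto simp: differentiable_def)
qed

lemma is_Ck_const: "is_Ck k (\<lambda>x. c)"
  by (induction k arbitrary: c) auto

lemma is_Ck_add: "is_Ck k f \<Longrightarrow> is_Ck k g \<Longrightarrow> is_Ck k (\<lambda>x. f x + g x)"
proof (induction k arbitrary: f g)
  case 0
  then show ?case by (simp add: continuous_on_add)
next
  case (Suc k)
  show ?case
    by (rule is_Ck_SucI[OF has_derivative_add[OF is_Ck_has_derivative is_Ck_has_derivative]])
       (use Suc in \<open>auto intro!: Suc.IH\<close>)
qed

lemma is_Ck_sum:
  "(\<And>i. i \<in> I \<Longrightarrow> is_Ck k (f i)) \<Longrightarrow> is_Ck k (\<lambda>x. \<Sum>i\<in>I. f i x)"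
  by (induction I rule: infinite_finite_induct) (auto intro: is_Ck_add is_Ck_const)

lemma is_Ck_bounded_linear: "bounded_linear h \<Longrightarrow> is_Ck k f \<Longrightarrow> is_Ck k (\<lambda>x. h (f x))"
proof (induction k arbitrary: f)
  case 0
  then show ?case by (simp add: bounded_linear.continuous_on)
next
  case (Suc k)
  show ?case
    by (rule is_Ck_SucI[OF bounded_linear.has_derivative[OF Suc.prems(1) is_Ck_has_derivative]])
       (use Suc in \<open>auto intro!: Suc.IH\<close>)
qed

text \<open>The product rule leaves two summands, each pairing one undifferentiated factor with one
  derivative. Both are of class \<open>k\<close>, so the induction hypothesis applies to
  each.\<close>

lemma is_Ck_bounded_bilinear:
  assumes "bounded_bilinear h"
  shows "is_Ck k f \<Longrightarrow> is_Ck k g \<Longrightarrow> is_Ck k (\<lambda>x. h (f x) (g x))"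
proof (induction k arbitrary: f g)
  case 0
  then show ?case using assms by (simp add: bounded_bilinear.continuous_on)
next
  case (Suc k)
  have fg: "is_Ck k f" "is_Ck k g" using Suc.prems is_Ck_Suc_imp by blast+
  show ?case
    by (rule is_Ck_SucI[OF bounded_bilinear.FDERIV[OF assms is_Ck_has_derivative is_Ck_has_derivative]])
       (use Suc fg in \<open>auto intro!: Suc.IH is_Ck_add\<close>)
qed

text \<open>\<open>is_Ck\<close> controls derivatives only in fixed directions, while the chain rule
  produces a direction that varies with the point. Linearity moves that variation into scalar
  coefficients.\<close>

lemma frechet_derivative_expand:
  assumes "f differentiable (at x)"
  shows "frechet_derivative f (at x) w = (\<Sum>b\<in>Basis. (w \<bullet> b) *\<^sub>R frechet_derivative f (at x) b)"
proof -
  have lin: "linear (frechet_derivative f (at x))"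
    using assms by (rule linear_frechet_derivative)
  have "frechet_derivative f (at x) w = frechet_derivative f (at x) (\<Sum>b\<in>Basis. (w \<bullet> b) *\<^sub>R b)"
    by (simp add: euclidean_representation)
  then show ?thesis
    by (simp add: linear_sum[OF lin] linear_cmul[OF lin])
qed

text \<open>By the chain rule a directional derivative of the composite is a sum of products of a
  component of the derivative of \<open>\<theta>\<close> with a derivative of \<open>f\<close>
  composed with the same \<open>\<theta>\<close>. Hence only \<open>f\<close> has to vary in the
  induction.\<close>

lemma is_Ck_compose:
  fixes f :: "'c::euclidean_space \<Rightarrow> 'b::real_normed_vector" and \<theta> :: "'a::euclidean_space \<Rightarrow> 'c"
  shows "is_Ck k f \<Longrightarrow> is_Ck k \<theta> \<Longrightarrow> is_Ck k (\<lambda>x. f (\<theta> x))"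
proof (induction k arbitrary: f)
  case 0
  then show ?case
    using continuous_on_compose2[of UNIV f UNIV \<theta>] by simp
next
  case (Suc k)
  have \<theta>: "is_Ck k \<theta>" using Suc.prems is_Ck_Suc_imp by blast
  have "((\<lambda>x. f (\<theta> x)) has_derivative
      (\<lambda>v. frechet_derivative f (at (\<theta> x)) (frechet_derivative \<theta> (at x) v))) (at x)" for x
    using has_derivative_compose[OF is_Ck_has_derivative[OF Suc.prems(2)]
        is_Ck_has_derivative[OF Suc.prems(1)]] .
  moreover have "is_Ck k (\<lambda>x. frechet_derivative f (at (\<theta> x)) (frechet_derivative \<theta> (at x) v))" for v
  proof -
    have "is_Ck k (\<lambda>x. \<Sum>b\<in>Basis. (frechet_derivative \<theta> (at x) v \<bullet> b) *\<^sub>R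
        frechet_derivative f (at (\<theta> x)) b)"
    proof (rule is_Ck_sum, rule is_Ck_bounded_bilinear[OF bounded_bilinear_scaleR])
      fix b :: 'c
      show "is_Ck k (\<lambda>x. frechet_derivative \<theta> (at x) v \<bullet> b)"
        by (rule is_Ck_bounded_linear[OF bounded_linear_inner_left is_Ck_frechet_derivative[OF Suc.prems(2)]])
      show "is_Ck k (\<lambda>x. frechet_derivative f (at (\<theta> x)) b)"
        by (rule Suc.IH[OF is_Ck_frechet_derivative[OF Suc.prems(1)] \<theta>])
    qed
    then show ?thesis
      by (subst frechet_derivative_expand[OF is_Ck_differentiable[OF Suc.prems(1)]])
  qed
  ultimately show ?case by (rule is_Ck_SucI)
qed

section \<open>Closure properties of smooth functions\<close>

lemma smooth_has_derivative:
  "smooth f \<Longrightarrow> (f has_derivative frechet_derivative f (at x)) (at x)"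
  unfolding smooth_def using is_Ck_has_derivative by blast

lemma smooth_differentiable: "smooth f \<Longrightarrow> f differentiable (at x)"
  unfolding smooth_def using is_Ck_differentiable by blast

lemma smooth_frechet_derivative: "smooth f \<Longrightarrow> smooth (\<lambda>x. frechet_derivative f (at x) v)"
  unfolding smooth_def using is_Ck_frechet_derivative by blast

lemma smooth_const: "smooth (\<lambda>x. c)"
  by (simp add: smooth_def is_Ck_const)

lemma smooth_add: "smooth f \<Longrightarrow> smooth g \<Longrightarrow> smooth (\<lambda>x. f x + g x)"
  by (simp add: smooth_def is_Ck_add)

lemma smooth_sum: "(\<And>i. i \<in> I \<Longrightarrow> smooth (f i)) \<Longrightarrow> smooth (\<lambda>x. \<Sum>i\<in>I. f i x)"
  by (simp add: smooth_def is_Ck_sum)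

lemma smooth_bounded_linear: "bounded_linear h \<Longrightarrow> smooth f \<Longrightarrow> smooth (\<lambda>x. h (f x))"
  by (simp add: smooth_def is_Ck_bounded_linear)

lemma smooth_mult:
  fixes f g :: "'a::euclidean_space \<Rightarrow> 'b::real_normed_algebra"
  shows "smooth f \<Longrightarrow> smooth g \<Longrightarrow> smooth (\<lambda>x. f x * g x)"
  by (simp add: smooth_def is_Ck_bounded_bilinear[OF bounded_bilinear_mult])

lemma smooth_prod:
  fixes f :: "'i \<Rightarrow> 'a::euclidean_space \<Rightarrow> 'b::{real_normed_algebra, comm_ring_1}"
  shows "(\<And>i. i \<in> I \<Longrightarrow> smooth (f i)) \<Longrightarrow> smooth (\<lambda>x. \<Prod>i\<in>I. f i x)"
  by (induction I rule: infinite_finite_induct) (auto intro: smooth_mult smooth_const)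

lemma smooth_power:
  fixes f :: "'a::euclidean_space \<Rightarrow> 'b::{real_normed_algebra, comm_ring_1}"
  shows "smooth f \<Longrightarrow> smooth (\<lambda>x. f x ^ n)"
  by (induction n) (auto intro: smooth_mult smooth_const)

lemma smooth_compose: "smooth f \<Longrightarrow> smooth \<theta> \<Longrightarrow> smooth (\<lambda>x. f (\<theta> x))"
  by (simp add: smooth_def is_Ck_compose)

lemma smooth_ident: "smooth (\<lambda>x. x)"
  unfolding smooth_def
proof
  show "is_Ck k (\<lambda>x::'a. x)" for k
    by (cases k) (auto intro: is_Ck_SucI[OF has_derivative_ident is_Ck_const] simp del: is_Ck.simps(2))
qed

section \<open>Symmetry of mixed second derivatives\<close>

text \<open>Two applications of the mean value theorem, first along \<open>u\<close> to a difference
  in direction \<open>v\<close>, then along \<open>v\<close> to the derivative in direction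
  \<open>u\<close>.\<close>

lemma second_difference_mvt:
  fixes f :: "'a::euclidean_space \<Rightarrow> real"
  assumes f: "smooth f" and h: "0 < h"
  obtains s t where "0 < s" "s < h" "0 < t" "t < h"
    "f (x + h *\<^sub>R u + h *\<^sub>R v) - f (x + h *\<^sub>R u) - f (x + h *\<^sub>R v) + f x =
      h\<^sup>2 * frechet_derivative (\<lambda>y. frechet_derivative f (at y) u) (at (x + s *\<^sub>R u + t *\<^sub>R v)) v"
proof -
  have line: "((\<lambda>s. g (a + s *\<^sub>R w)) has_real_derivative
      frechet_derivative g (at (a + s *\<^sub>R w)) w) (at s)"
    if "smooth g" for g :: "'a \<Rightarrow> real" and a w s
  proof -
    have "((\<lambda>s. a + s *\<^sub>R w) has_derivative (\<lambda>r. r *\<^sub>R w)) (at s)"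
      by (auto intro!: derivative_eq_intros)
    from has_derivative_compose[OF this smooth_has_derivative[OF that]]
    have "((\<lambda>s. g (a + s *\<^sub>R w)) has_derivative
        (\<lambda>r. frechet_derivative g (at (a + s *\<^sub>R w)) (r *\<^sub>R w))) (at s)" .
    moreover have "(\<lambda>r. frechet_derivative g (at (a + s *\<^sub>R w)) (r *\<^sub>R w)) =
        (*) (frechet_derivative g (at (a + s *\<^sub>R w)) w)"
      using linear_cmul[OF linear_frechet_derivative[OF smooth_differentiable[OF that]]] by auto
    ultimately show ?thesis by (simp add: has_field_derivative_def)
  qed
  \<comment> \<open>The second difference is \<open>p h - p 0\<close>, and the derivative of
    \<open>p\<close> is again a difference in direction \<open>v\<close>.\<close>
  define p where "p s = f ((x + h *\<^sub>R v) + s *\<^sub>R u) - f (x + s *\<^sub>R u)" for s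
  define g where "g y = frechet_derivative f (at y) u" for y
  have g: "smooth g" unfolding g_def by (rule smooth_frechet_derivative[OF f])
  have p: "(p has_real_derivative g ((x + h *\<^sub>R v) + s *\<^sub>R u) - g (x + s *\<^sub>R u)) (at s)" for s
    unfolding p_def g_def by (rule DERIV_diff[OF line[OF f] line[OF f]])
  obtain s where s: "0 < s" "s < h" and
    ps: "p h - p 0 = (h - 0) * (g ((x + h *\<^sub>R v) + s *\<^sub>R u) - g (x + s *\<^sub>R u))"
    using MVT2[OF h p] by blast
  obtain t where t: "0 < t" "t < h" and
    gt: "g ((x + s *\<^sub>R u) + h *\<^sub>R v) - g ((x + s *\<^sub>R u) + 0 *\<^sub>R v) =
      (h - 0) * frechet_derivative g (at ((x + s *\<^sub>R u) + t *\<^sub>R v)) v"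
    using MVT2[OF h line[OF g]] by blast
  have "p h - p 0 = h * (h * frechet_derivative g (at ((x + s *\<^sub>R u) + t *\<^sub>R v)) v)"
    using ps gt by (simp add: algebra_simps)
  then show ?thesis
    using that[OF s t] by (simp add: p_def g_def[symmetric] algebra_simps power2_eq_square)
qed

text \<open>The second difference does not change when \<open>u\<close> and \<open>v\<close> are
  exchanged. Hence the two mixed derivatives share a value at points arbitrarily close to
  \<open>x\<close>, and continuity forces them to agree at \<open>x\<close>.\<close>

lemma frechet_derivative_commute_real:
  fixes f :: "'a::euclidean_space \<Rightarrow> real"
  assumes f: "smooth f"
  shows "frechet_derivative (\<lambda>y. frechet_derivative f (at y) u) (at x) v =
    frechet_derivative (\<lambda>y. frechet_derivative f (at y) v) (at x) u"
proof (rule ccontr)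
  define F where "F = (\<lambda>x. frechet_derivative (\<lambda>y. frechet_derivative f (at y) u) (at x) v)"
  define H where "H = (\<lambda>x. frechet_derivative (\<lambda>y. frechet_derivative f (at y) v) (at x) u)"
  assume "\<not> ?thesis"
  then have ne: "F x \<noteq> H x" by (simp add: F_def H_def)
  have "isCont F x" "isCont H x"
    unfolding F_def H_def
    by (intro differentiable_imp_continuous_within smooth_differentiable smooth_frechet_derivative f)+
  moreover define e where "e = \<bar>F x - H x\<bar> / 2"
  moreover have "e > 0" using ne by (simp add: e_def)
  ultimately obtain d1 d2 where d: "d1 > 0" "d2 > 0"
    and d1: "\<And>y. dist y x < d1 \<Longrightarrow> dist (F y) (F x) < e"
    and d2: "\<And>y. dist y x < d2 \<Longrightarrow> dist (H y) (H x) < e"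
    unfolding continuous_at_eps_delta by blast
  \<comment> \<open>The summand 1 makes \<open>m\<close> positive and
    \<open>norm u + norm v < m\<close> strict, so every intermediate point lies within
    \<open>h * m = min d1 d2\<close> of \<open>x\<close>.\<close>
  define m where "m = norm u + norm v + 1"
  have m: "m > 0" by (simp add: m_def add_nonneg_pos)
  define h where "h = min d1 d2 / m"
  have h: "h > 0" using d m by (simp add: h_def)
  have near: "dist (x + s *\<^sub>R a + t *\<^sub>R b) x < min d1 d2"
    if "0 < s" "s < h" "0 < t" "t < h" and ab: "norm a + norm b < m" for s t a b
  proof -
    have "dist (x + s *\<^sub>R a + t *\<^sub>R b) x = norm (s *\<^sub>R a + t *\<^sub>R b)"
      by (simp add: dist_norm add.assoc)
    also have "\<dots> \<le> s * norm a + t * norm b"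
      using norm_triangle_ineq[of "s *\<^sub>R a" "t *\<^sub>R b"] that by simp
    also have "\<dots> \<le> h * norm a + h * norm b"
      using that by (intro add_mono mult_right_mono) auto
    also have "\<dots> < h * m"
      using ab h by (simp flip: distrib_left)
    finally show ?thesis using m by (simp add: h_def)
  qed
  obtain s t where st: "0 < s" "s < h" "0 < t" "t < h" and
    1: "f (x + h *\<^sub>R u + h *\<^sub>R v) - f (x + h *\<^sub>R u) - f (x + h *\<^sub>R v) + f x =
      h\<^sup>2 * F (x + s *\<^sub>R u + t *\<^sub>R v)"
    using second_difference_mvt[OF f h, of x u v] unfolding F_def by blast
  obtain s' t' where st': "0 < s'" "s' < h" "0 < t'" "t' < h" and
    2: "f (x + h *\<^sub>R v + h *\<^sub>R u) - f (x + h *\<^sub>R v) - f (x + h *\<^sub>R u) + f x =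
      h\<^sup>2 * H (x + s' *\<^sub>R v + t' *\<^sub>R u)"
    using second_difference_mvt[OF f h, of x v u] unfolding H_def by blast
  have "f (x + h *\<^sub>R v + h *\<^sub>R u) = f (x + h *\<^sub>R u + h *\<^sub>R v)" by (simp add: ac_simps)
  then have "h\<^sup>2 * F (x + s *\<^sub>R u + t *\<^sub>R v) = h\<^sup>2 * H (x + s' *\<^sub>R v + t' *\<^sub>R u)"
    using 1 2 by linarith
  then have "F (x + s *\<^sub>R u + t *\<^sub>R v) = H (x + s' *\<^sub>R v + t' *\<^sub>R u)" using h by simp
  moreover have "dist (F (x + s *\<^sub>R u + t *\<^sub>R v)) (F x) < e"
    using near[OF st, of u v] by (intro d1) (simp add: m_def)
  moreover have "dist (H (x + s' *\<^sub>R v + t' *\<^sub>R u)) (H x) < e"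
    using near[OF st', of v u] by (intro d2) (simp add: m_def)
  \<comment> \<open>The common value is within \<open>e\<close> of both \<open>F x\<close> and
    \<open>H x\<close>, whose distance is \<open>2 * e\<close>.\<close>
  ultimately show False by (simp add: e_def dist_real_def abs_if split: if_splits)
qed

text \<open>Pairing with a fixed vector \<open>e\<close> reduces to the real case. Choosing
  \<open>e\<close> to be the difference of both sides shows that this difference is orthogonal to
  itself. The complex numbers are covered as a real inner product space.\<close>

lemma frechet_derivative_commute:
  fixes f :: "'a::euclidean_space \<Rightarrow> 'b::real_inner"
  assumes f: "smooth f"
  shows "frechet_derivative (\<lambda>y. frechet_derivative f (at y) u) (at x) v =
    frechet_derivative (\<lambda>y. frechet_derivative f (at y) v) (at x) u" (is "?l = ?r")
proof -
  have inner: "frechet_derivative (\<lambda>y. g y \<bullet> e) (at x) w = frechet_derivative g (at x) w \<bullet> e"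
    if "smooth g" for g :: "'a \<Rightarrow> 'b" and e x w
    using frechet_derivative_at[OF bounded_linear.has_derivative[OF bounded_linear_inner_left
          smooth_has_derivative[OF that]], of x e] by metis
  have "?l \<bullet> e = ?r \<bullet> e" for e
  proof -
    have "smooth (\<lambda>y. f y \<bullet> e)"
      by (rule smooth_bounded_linear[OF bounded_linear_inner_left f])
    from frechet_derivative_commute_real[OF this, of u x v] show ?thesis
      by (simp add: inner f smooth_frechet_derivative)
  qed
  then have "?l \<bullet> (?l - ?r) = ?r \<bullet> (?l - ?r)" .
  then have "(?l - ?r) \<bullet> (?l - ?r) = 0" by (simp add: inner_diff_left)
  then show ?thesis by simp
qed

section \<open>Iterated partial derivatives\<close>

lemma smooth_partial_deriv: "smooth f \<Longrightarrow> smooth (partial_deriv i f)"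
  unfolding partial_deriv_def by (rule smooth_frechet_derivative)

lemma smooth_partial_deriv_funpow: "smooth f \<Longrightarrow> smooth ((partial_deriv i ^^ n) f)"
  by (induction n) (auto intro: smooth_partial_deriv)

lemma partial_deriv_commute:
  "smooth f \<Longrightarrow> partial_deriv i (partial_deriv j f) = partial_deriv j (partial_deriv i f)"
  unfolding partial_deriv_def using frechet_derivative_commute by blast

lemma partial_deriv_eqI:
  "(\<And>x. (f has_derivative f' x) (at x)) \<Longrightarrow> partial_deriv i f = (\<lambda>x. f' x (axis i 1))"
  unfolding partial_deriv_def using frechet_derivative_at by metis

lemma smooth_linear_combination:
  fixes f :: "'i \<Rightarrow> 'a::euclidean_space \<Rightarrow> complex"
  shows "(\<And>i. i \<in> I \<Longrightarrow> smooth (f i)) \<Longrightarrow> smooth (\<lambda>x. \<Sum>i\<in>I. c i * f i x)"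
  by (intro smooth_sum smooth_mult smooth_const)

lemma partial_deriv_linear_combination:
  assumes "\<And>i. i \<in> I \<Longrightarrow> smooth (f i)"
  shows "partial_deriv j (\<lambda>x. \<Sum>i\<in>I. c i * f i x) = (\<lambda>x. \<Sum>i\<in>I. c i * partial_deriv j (f i) x)"
proof -
  have "((\<lambda>x. \<Sum>i\<in>I. c i * f i x) has_derivative
      (\<lambda>v. \<Sum>i\<in>I. c i * frechet_derivative (f i) (at x) v)) (at x)" for x
    by (intro has_derivative_sum has_derivative_mult_right smooth_has_derivative assms)
  from partial_deriv_eqI[OF this] show ?thesis
    by (simp add: partial_deriv_def)
qed

lemma partial_deriv_funpow_linear_combination:
  assumes "\<And>i. i \<in> I \<Longrightarrow> smooth (f i)"
  shows "(partial_deriv j ^^ n) (\<lambda>x. \<Sum>i\<in>I. c i * f i x) =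
    (\<lambda>x. \<Sum>i\<in>I. c i * (partial_deriv j ^^ n) (f i) x)"
  by (induction n)
     (simp_all add: partial_deriv_linear_combination smooth_partial_deriv_funpow assms)

lemma smooth_foldr_partial_deriv:
  "smooth f \<Longrightarrow> smooth (foldr (\<lambda>i. partial_deriv i ^^ \<alpha> i) is f)"
  by (induction "is") (auto intro: smooth_partial_deriv_funpow)

lemma foldr_partial_deriv_linear_combination:
  assumes "\<And>i. i \<in> I \<Longrightarrow> smooth (f i)"
  shows "foldr (\<lambda>i. partial_deriv i ^^ \<alpha> i) is (\<lambda>x. \<Sum>i\<in>I. c i * f i x) =
    (\<lambda>x. \<Sum>i\<in>I. c i * foldr (\<lambda>i. partial_deriv i ^^ \<alpha> i) is (f i) x)"
  by (induction "is")
     (simp_all add: partial_deriv_funpow_linear_combination smooth_foldr_partial_deriv assms)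

lemma partial_deriv_funpow_commute:
  assumes "smooth f"
  shows "partial_deriv i ((partial_deriv j ^^ n) f) = (partial_deriv j ^^ n) (partial_deriv i f)"
  by (induction n)
     (simp_all add: partial_deriv_commute[of _ i j] smooth_partial_deriv_funpow assms)

text \<open>The new derivative commutes past the blocks of the other coordinates until it meets the
  block of \<open>i\<close>. Distinctness guarantees that only this block changes its
  exponent.\<close>

lemma partial_deriv_foldr:
  assumes "smooth f" "distinct is" "i \<in> set is"
  shows "partial_deriv i (foldr (\<lambda>i. partial_deriv i ^^ \<alpha> i) is f) =
    foldr (\<lambda>j. partial_deriv j ^^ (\<alpha>(i := Suc (\<alpha> i))) j) is f"
  using assms(2,3)
proof (induction "is")
  case (Cons j js)
  show ?case
  proof (cases "i = j")
    case True
    then have "i \<notin> set js" using Cons.prems by simp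
    then have "foldr (\<lambda>j. partial_deriv j ^^ (\<alpha>(i := Suc (\<alpha> i))) j) js f =
        foldr (\<lambda>i. partial_deriv i ^^ \<alpha> i) js f"
      by (intro foldr_cong) auto
    then show ?thesis using True by simp
  next
    case False
    then show ?thesis
      using Cons by (simp add: partial_deriv_funpow_commute smooth_foldr_partial_deriv assms(1))
  qed
qed simp

lemma distinct_coords: "distinct (coords :: 'd::finite list)"
  and set_coords: "set (coords :: 'd::finite list) = UNIV"
proof -
  have "\<exists>is::'d list. distinct is \<and> set is = UNIV"
    using finite_distinct_list[of "UNIV :: 'd set"] by auto
  from someI_ex[OF this] show "distinct (coords :: 'd list)" "set (coords :: 'd list) = UNIV"
    unfolding coords_def by auto
qed

lemma mi_abs_coords: "mi_abs \<alpha> = sum_list (map \<alpha> coords)"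
  by (simp add: mi_abs_def sum_list_distinct_conv_sum_set distinct_coords set_coords)

lemma mi_abs_Suc: "mi_abs (\<alpha>(i := Suc (\<alpha> i))) = Suc (mi_abs \<alpha>)"
proof -
  have "mi_abs \<beta> = \<beta> i + (\<Sum>j\<in>UNIV - {i}. \<beta> j)" for \<beta> :: "'a \<Rightarrow> nat"
    unfolding mi_abs_def by (rule sum.remove) auto
  from this[of "\<alpha>(i := Suc (\<alpha> i))"] this[of \<alpha>] show ?thesis by simp
qed

lemma smooth_multi_D: "smooth f \<Longrightarrow> smooth (multi_D \<alpha> f)"
  unfolding multi_D_def multi_deriv_def divide_inverse
  by (intro smooth_mult smooth_const smooth_foldr_partial_deriv)

lemma multi_D_linear_combination:
  assumes "\<And>i. i \<in> I \<Longrightarrow> smooth (f i)"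
  shows "multi_D \<alpha> (\<lambda>x. \<Sum>i\<in>I. c i * f i x) = (\<lambda>x. \<Sum>i\<in>I. c i * multi_D \<alpha> (f i) x)"
  unfolding multi_D_def multi_deriv_def
  by (simp add: foldr_partial_deriv_linear_combination assms sum_divide_distrib)

text \<open>The factor \<open>\<i>\<close> compensates the additional division by
  \<open>\<i>\<close> in the operator of one higher order.\<close>

lemma partial_deriv_multi_D:
  assumes "smooth f"
  shows "partial_deriv i (multi_D \<alpha> f) = (\<lambda>x. \<i> * multi_D (\<alpha>(i := Suc (\<alpha> i))) f x)"
proof -
  have "partial_deriv i (multi_deriv \<alpha> f) = multi_deriv (\<alpha>(i := Suc (\<alpha> i))) f"
    unfolding multi_deriv_def
    by (rule partial_deriv_foldr) (simp_all add: assms distinct_coords set_coords)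
  \<comment> \<open>The sum over a singleton puts the constant factor into the form of the linear
    combination lemma.\<close>
  moreover have "partial_deriv i (\<lambda>x. \<Sum>j\<in>{()}. inverse (\<i> ^ mi_abs \<alpha>) * multi_deriv \<alpha> f x) =
      (\<lambda>x. \<Sum>j\<in>{()}. inverse (\<i> ^ mi_abs \<alpha>) * partial_deriv i (multi_deriv \<alpha> f) x)"
    by (intro partial_deriv_linear_combination)
       (simp add: multi_deriv_def smooth_foldr_partial_deriv assms)
  ultimately show ?thesis
    unfolding multi_D_def mi_abs_Suc by (simp add: field_simps)
qed

lemma multi_D_0: "multi_D (\<lambda>i. 0) f = f"
proof -
  have "foldr (\<lambda>i. partial_deriv i ^^ 0) is f = f" for "is"
    by (induction "is") auto
  then show ?thesis by (simp add: multi_D_def multi_deriv_def mi_abs_def)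
qed

text \<open>The monomials \<open>(x - y)\<^sup>\<alpha>\<close> are the test functions that read off the coefficients of a
  differential operator at \<open>y\<close>.\<close>

definition monomial_at :: "complex \<Rightarrow> real^'d::finite \<Rightarrow> ('d \<Rightarrow> nat) \<Rightarrow> real^'d \<Rightarrow> complex" where
  "monomial_at c y \<alpha> = (\<lambda>x. c * (\<Prod>j\<in>UNIV. complex_of_real (x $ j - y $ j) ^ \<alpha> j))"

lemma bounded_linear_of_real_vec_nth:
  "bounded_linear (\<lambda>x :: real^'d::finite. complex_of_real (x $ j))"
  using bounded_linear_compose[OF bounded_linear_of_real bounded_linear_vec_nth] .

lemma smooth_monomial_at: "smooth (monomial_at c y \<alpha>)"
proof -
  have "smooth (\<lambda>x. complex_of_real (x $ j) + - complex_of_real (y $ j))" for j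
    by (intro smooth_add smooth_const smooth_bounded_linear[OF bounded_linear_of_real_vec_nth]
        smooth_ident)
  then have "smooth (\<lambda>x. complex_of_real (x $ j - y $ j))" for j by simp
  then show ?thesis
    unfolding monomial_at_def by (intro smooth_mult smooth_const smooth_prod smooth_power)
qed

text \<open>The scalar \<open>c\<close> keeps derivatives inside the family. For
  \<open>\<alpha> i = 0\<close> the truncated exponent is harmless, since the scalar becomes
  0.\<close>

lemma partial_deriv_monomial_at:
  "partial_deriv i (monomial_at c y \<alpha>) =
    monomial_at (c * of_nat (\<alpha> i)) y (\<alpha>(i := \<alpha> i - 1))"
proof -
  let ?p = "\<lambda>x j. complex_of_real (x $ j - y $ j)"
  have d: "((\<lambda>x. ?p x j) has_derivative (\<lambda>v. complex_of_real (v $ j))) (at x)" for x j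
    using has_derivative_diff[OF bounded_linear_imp_has_derivative[OF bounded_linear_of_real_vec_nth]
        has_derivative_const]
    by simp
  have "(monomial_at c y \<alpha> has_derivative
      (\<lambda>v. c * (\<Sum>j\<in>UNIV. (of_nat (\<alpha> j) * complex_of_real (v $ j) * ?p x j ^ (\<alpha> j - 1)) *
        (\<Prod>k\<in>UNIV - {j}. ?p x k ^ \<alpha> k)))) (at x)" for x
    unfolding monomial_at_def
    by (intro has_derivative_mult_right has_derivative_prod has_derivative_power d)
  from partial_deriv_eqI[OF this, of i]
  have pd: "partial_deriv i (monomial_at c y \<alpha>) = (\<lambda>x. c * (\<Sum>j\<in>UNIV. (of_nat (\<alpha> j) *
      complex_of_real ((axis i 1 :: real^'a) $ j) * ?p x j ^ (\<alpha> j - 1)) *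
        (\<Prod>k\<in>UNIV - {j}. ?p x k ^ \<alpha> k)))" .
  have eq: "(\<Sum>j\<in>UNIV. (of_nat (\<alpha> j) * complex_of_real ((axis i 1 :: real^'a) $ j) *
      ?p x j ^ (\<alpha> j - 1)) * (\<Prod>k\<in>UNIV - {j}. ?p x k ^ \<alpha> k)) =
      of_nat (\<alpha> i) * (\<Prod>k\<in>UNIV. ?p x k ^ (\<alpha>(i := \<alpha> i - 1)) k)" (is "?l = ?r") for x
  proof -
    have "?l = (\<Sum>j\<in>UNIV. if j = i then of_nat (\<alpha> i) * ?p x i ^ (\<alpha> i - 1) *
        (\<Prod>k\<in>UNIV - {i}. ?p x k ^ \<alpha> k) else 0)"
      by (intro sum.cong) (auto simp: axis_def)
    also have "\<dots> = ?r"
      by (simp add: prod.remove[of UNIV i])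
    finally show ?thesis .
  qed
  show ?thesis unfolding pd eq by (simp only: monomial_at_def mult.assoc)
qed

text \<open>The product is a falling factorial. With truncated subtraction it vanishes exactly when
  \<open>\<alpha> i < n\<close>, because the factor for \<open>m = \<alpha> i\<close> then
  occurs.\<close>

lemma partial_deriv_funpow_monomial_at:
  "(partial_deriv i ^^ n) (monomial_at c y \<alpha>) =
    monomial_at (c * (\<Prod>m<n. of_nat (\<alpha> i - m))) y (\<alpha>(i := \<alpha> i - n))"
proof (induction n)
  case (Suc n)
  have "(\<alpha>(i := \<alpha> i - n))(i := \<alpha> i - n - 1) = \<alpha>(i := \<alpha> i - Suc n)" by simp
  then show ?case
    unfolding funpow.simps o_apply Suc partial_deriv_monomial_at
    by (simp only: fun_upd_same prod.lessThan_Suc mult.assoc)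
qed simp

lemma foldr_partial_deriv_monomial_at:
  "distinct is \<Longrightarrow> foldr (\<lambda>i. partial_deriv i ^^ \<beta> i) is (monomial_at c y \<alpha>) =
    monomial_at (c * (\<Prod>i\<in>set is. \<Prod>m<\<beta> i. of_nat (\<alpha> i - m))) y
      (\<lambda>i. if i \<in> set is then \<alpha> i - \<beta> i else \<alpha> i)"
proof (induction "is")
  case (Cons j js)
  have "(\<lambda>i. if i \<in> set js then \<alpha> i - \<beta> i else \<alpha> i)(j := \<alpha> j - \<beta> j) =
      (\<lambda>i. if i \<in> set (j # js) then \<alpha> i - \<beta> i else \<alpha> i)"
    by auto
  then show ?case
    using Cons by (simp add: partial_deriv_funpow_monomial_at mult_ac)
qed simp

text \<open>If some \<open>\<beta> i\<close> exceeds \<open>\<alpha> i\<close>, the falling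
  factorial is zero. If some \<open>\<beta> i\<close> is smaller, a positive power of zero remains
  at \<open>y\<close>. Neither happens only when the two multi-indices agree.\<close>

lemma multi_D_monomial_at_eq_0_iff: "multi_D \<beta> (monomial_at 1 y \<alpha>) y = 0 \<longleftrightarrow> \<alpha> \<noteq> \<beta>"
proof -
  have "multi_D \<beta> (monomial_at 1 y \<alpha>) y = 0 \<longleftrightarrow>
      (\<exists>i. (\<Prod>m<\<beta> i. of_nat (\<alpha> i - m)) = (0::complex)) \<or> (\<exists>i. \<beta> i < \<alpha> i)"
    unfolding multi_D_def multi_deriv_def foldr_partial_deriv_monomial_at[OF distinct_coords]
      set_coords
    unfolding monomial_at_def by auto
  also have "\<dots> \<longleftrightarrow> (\<exists>i. \<alpha> i < \<beta> i) \<or> (\<exists>i. \<beta> i < \<alpha> i)"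
    by (auto intro: le_less_trans)
  also have "\<dots> \<longleftrightarrow> \<alpha> \<noteq> \<beta>" by (auto simp: fun_eq_iff neq_iff)
  finally show ?thesis .
qed

section \<open>Differential operators along a smooth map\<close>

text \<open>Only the values of \<open>L\<close> on smooth functions matter. Such operators carry the coefficient
  along \<open>\<theta> = \<phi>\<inverse>\<close> and the order bound that makes a symbol out of a composition.\<close>

definition diff_op_along ::
  "(real^'d::finite \<Rightarrow> real^'d) \<Rightarrow> nat \<Rightarrow> ((real^'d \<Rightarrow> complex) \<Rightarrow> real^'d \<Rightarrow> complex) \<Rightarrow> bool" where
  "diff_op_along \<theta> n L \<longleftrightarrow> (\<exists>c. (\<forall>\<alpha>. smooth (c \<alpha>)) \<and>
     (\<forall>f. smooth f \<longrightarrow> L f = (\<lambda>x. \<Sum>\<alpha> | mi_abs \<alpha> \<le> n. c \<alpha> x * multi_D \<alpha> f (\<theta> x))))"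

lemma diff_op_along_cong:
  assumes "diff_op_along \<theta> n L" "\<And>f. smooth f \<Longrightarrow> L f = L' f"
  shows "diff_op_along \<theta> n L'"
  using assms(1) unfolding diff_op_along_def by (simp add: assms(2) cong: conj_cong imp_cong)

lemma diff_op_along_0: "diff_op_along \<theta> n (\<lambda>f x. 0)"
  unfolding diff_op_along_def by (intro exI[of _ "\<lambda>\<alpha> x. 0"]) (simp add: smooth_const)

lemma diff_op_along_add:
  assumes "diff_op_along \<theta> n L" "diff_op_along \<theta> n M"
  shows "diff_op_along \<theta> n (\<lambda>f x. L f x + M f x)"
proof -
  from assms obtain c d where "\<forall>\<alpha>. smooth (c \<alpha>)" "\<forall>\<alpha>. smooth (d \<alpha>)" and
    "\<forall>f. smooth f \<longrightarrow> L f = (\<lambda>x. \<Sum>\<alpha> | mi_abs \<alpha> \<le> n. c \<alpha> x * multi_D \<alpha> f (\<theta> x))"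
    "\<forall>f. smooth f \<longrightarrow> M f = (\<lambda>x. \<Sum>\<alpha> | mi_abs \<alpha> \<le> n. d \<alpha> x * multi_D \<alpha> f (\<theta> x))"
    unfolding diff_op_along_def by auto
  then show ?thesis
    unfolding diff_op_along_def
    by (intro exI[of _ "\<lambda>\<alpha> x. c \<alpha> x + d \<alpha> x"])
       (auto simp: smooth_add algebra_simps sum.distrib)
qed

lemma diff_op_along_sum:
  "(\<And>i. i \<in> I \<Longrightarrow> diff_op_along \<theta> n (L i)) \<Longrightarrow> diff_op_along \<theta> n (\<lambda>f x. \<Sum>i\<in>I. L i f x)"
  by (induction I rule: infinite_finite_induct)
     (auto intro: diff_op_along_0 diff_op_along_add)

lemma diff_op_along_mult:
  assumes "diff_op_along \<theta> n L" "smooth h"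
  shows "diff_op_along \<theta> n (\<lambda>f x. h x * L f x)"
proof -
  from assms obtain c where "\<forall>\<alpha>. smooth (c \<alpha>)" and
    "\<forall>f. smooth f \<longrightarrow> L f = (\<lambda>x. \<Sum>\<alpha> | mi_abs \<alpha> \<le> n. c \<alpha> x * multi_D \<alpha> f (\<theta> x))"
    unfolding diff_op_along_def by auto
  then show ?thesis
    unfolding diff_op_along_def
    by (intro exI[of _ "\<lambda>\<alpha> x. h x * c \<alpha> x"])
       (auto simp: smooth_mult assms(2) sum_distrib_left mult_ac)
qed

lemma diff_op_along_multi_D:
  assumes "mi_abs \<beta> \<le> n"
  shows "diff_op_along \<theta> n (\<lambda>f x. multi_D \<beta> f (\<theta> x))"
proof -
  have "multi_D \<beta> f (\<theta> x) =
      (\<Sum>\<alpha> | mi_abs \<alpha> \<le> n. (if \<alpha> = \<beta> then 1 else 0) * multi_D \<alpha> f (\<theta> x))" for f x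
    using assms by (subst sum.remove[of _ \<beta>]) (auto simp: finite_mi_abs_le)
  then show ?thesis
    unfolding diff_op_along_def
    by (intro exI[of _ "\<lambda>\<alpha> x. if \<alpha> = \<beta> then 1 else 0"] conjI allI impI smooth_const ext)
qed

lemma diff_op_along_mono:
  assumes "diff_op_along \<theta> n L" "n \<le> m"
  shows "diff_op_along \<theta> m L"
proof -
  from assms obtain c where c: "\<forall>\<alpha>. smooth (c \<alpha>)" and
    L: "\<And>f. smooth f \<Longrightarrow> L f = (\<lambda>x. \<Sum>\<alpha> | mi_abs \<alpha> \<le> n. c \<alpha> x * multi_D \<alpha> f (\<theta> x))"
    unfolding diff_op_along_def by auto
  \<comment> \<open>Every summand has order at most \<open>m\<close>, so the closure lemmas supply
    the zero coefficients above order \<open>n\<close>.\<close>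
  have "diff_op_along \<theta> m (\<lambda>f x. \<Sum>\<alpha> | mi_abs \<alpha> \<le> n. c \<alpha> x * multi_D \<alpha> f (\<theta> x))"
    using c assms(2)
    by (intro diff_op_along_sum diff_op_along_mult diff_op_along_multi_D) auto
  then show ?thesis by (rule diff_op_along_cong) (simp add: L)
qed

lemma diff_op_along_smooth:
  assumes "diff_op_along \<theta> n L" "smooth \<theta>" "smooth f"
  shows "smooth (L f)"
proof -
  from assms obtain c where c: "\<And>\<alpha>. smooth (c \<alpha>)" and
    L: "L f = (\<lambda>x. \<Sum>\<alpha> | mi_abs \<alpha> \<le> n. c \<alpha> x * multi_D \<alpha> f (\<theta> x))"
    unfolding diff_op_along_def by auto
  show ?thesis
    unfolding L
    by (intro smooth_sum smooth_mult c smooth_compose[OF smooth_multi_D[OF assms(3)] assms(2)])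
qed

lemma diff_op_along_linear_combination:
  assumes "diff_op_along \<theta> n L" "\<And>i. i \<in> I \<Longrightarrow> smooth (f i)"
  shows "L (\<lambda>x. \<Sum>i\<in>I. c i * f i x) = (\<lambda>x. \<Sum>i\<in>I. c i * L (f i) x)"
proof -
  from assms(1) obtain d where
    L: "\<And>f. smooth f \<Longrightarrow> L f = (\<lambda>x. \<Sum>\<alpha> | mi_abs \<alpha> \<le> n. d \<alpha> x * multi_D \<alpha> f (\<theta> x))"
    unfolding diff_op_along_def by auto
  have "L (\<lambda>x. \<Sum>i\<in>I. c i * f i x) x = (\<Sum>i\<in>I. c i * L (f i) x)" for x
  proof -
    have "L (\<lambda>x. \<Sum>i\<in>I. c i * f i x) x =
        (\<Sum>\<alpha> | mi_abs \<alpha> \<le> n. \<Sum>i\<in>I. c i * (d \<alpha> x * multi_D \<alpha> (f i) (\<theta> x)))"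
      by (simp add: L smooth_linear_combination multi_D_linear_combination assms(2)
          sum_distrib_left mult_ac)
    also have "\<dots> = (\<Sum>i\<in>I. \<Sum>\<alpha> | mi_abs \<alpha> \<le> n. c i * (d \<alpha> x * multi_D \<alpha> (f i) (\<theta> x)))"
      by (rule sum.swap)
    also have "\<dots> = (\<Sum>i\<in>I. c i * L (f i) x)"
      by (simp add: L assms(2) sum_distrib_left)
    finally show ?thesis .
  qed
  then show ?thesis by blast
qed

section \<open>Leibniz rule, chain rule and growth of the order\<close>

lemma partial_deriv_mult:
  assumes "smooth f" "smooth g"
  shows "partial_deriv i (\<lambda>x. f x * g x) = (\<lambda>x. f x * partial_deriv i g x + partial_deriv i f x * g x)"
  using partial_deriv_eqI[OF has_derivative_mult[OF smooth_has_derivative[OF assms(1)]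
        smooth_has_derivative[OF assms(2)]]]
  by (simp add: partial_deriv_def)

lemma partial_deriv_compose:
  fixes f :: "real^'d::finite \<Rightarrow> complex"
  assumes "smooth f" "smooth \<theta>"
  shows "partial_deriv i (\<lambda>x. f (\<theta> x)) =
    (\<lambda>x. \<Sum>j\<in>UNIV. of_real (frechet_derivative \<theta> (at x) (axis i 1) $ j) * partial_deriv j f (\<theta> x))"
proof -
  have "partial_deriv i (\<lambda>x. f (\<theta> x)) x =
      frechet_derivative f (at (\<theta> x)) (frechet_derivative \<theta> (at x) (axis i 1))" for x
    using partial_deriv_eqI[OF has_derivative_compose[OF smooth_has_derivative[OF assms(2)]
          smooth_has_derivative[OF assms(1)]]] by metis
  moreover have "frechet_derivative f (at y) v = (\<Sum>j\<in>UNIV. of_real (v $ j) * partial_deriv j f y)"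
    for y v
  proof -
    have lin: "linear (frechet_derivative f (at y))"
      by (rule linear_frechet_derivative[OF smooth_differentiable[OF assms(1)]])
    have "frechet_derivative f (at y) v = frechet_derivative f (at y) (\<Sum>j\<in>UNIV. (v $ j) *\<^sub>R axis j 1)"
      using basis_expansion[of v] by (simp add: scalar_mult_eq_scaleR)
    also have "\<dots> = (\<Sum>j\<in>UNIV. (v $ j) *\<^sub>R partial_deriv j f y)"
      by (simp add: linear_sum[OF lin] linear_cmul[OF lin] partial_deriv_def)
    finally show ?thesis by (simp add: scaleR_conv_of_real)
  qed
  ultimately show ?thesis by (simp only: fun_eq_iff) blast
qed

text \<open>When the derivative falls on a coefficient the order stays. When it falls on a composed
  derivative of \<open>f\<close>, the chain rule raises the order by one and contributes entries of
  the Jacobian of \<open>\<theta>\<close>, which are smooth coefficients.\<close>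

lemma diff_op_along_partial_deriv:
  assumes "diff_op_along \<theta> n L" "smooth \<theta>"
  shows "diff_op_along \<theta> (Suc n) (\<lambda>f. partial_deriv i (L f))"
proof -
  from assms obtain c where c: "\<And>\<alpha>. smooth (c \<alpha>)" and
    L: "\<And>f. smooth f \<Longrightarrow> L f = (\<lambda>x. \<Sum>\<alpha> | mi_abs \<alpha> \<le> n. c \<alpha> x * multi_D \<alpha> f (\<theta> x))"
    unfolding diff_op_along_def by auto
  let ?J = "\<lambda>x j. complex_of_real (frechet_derivative \<theta> (at x) (axis i 1) $ j)"
  have J: "smooth (\<lambda>x. ?J x j)" for j
    by (rule smooth_bounded_linear[OF bounded_linear_of_real_vec_nth
          smooth_frechet_derivative[OF assms(2)]])
  have summand: "diff_op_along \<theta> (Suc n) (\<lambda>f x.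
      c \<alpha> x * (\<Sum>j\<in>UNIV. ?J x j * (\<i> * multi_D (\<alpha>(j := Suc (\<alpha> j))) f (\<theta> x))) +
      partial_deriv i (c \<alpha>) x * multi_D \<alpha> f (\<theta> x))" if "mi_abs \<alpha> \<le> n" for \<alpha>
    using that
    by (intro diff_op_along_add diff_op_along_sum diff_op_along_mult diff_op_along_multi_D J
        smooth_partial_deriv smooth_const c) (auto simp: mi_abs_Suc)
  have eq: "partial_deriv i (L f) = (\<lambda>x. \<Sum>\<alpha> | mi_abs \<alpha> \<le> n.
      c \<alpha> x * (\<Sum>j\<in>UNIV. ?J x j * (\<i> * multi_D (\<alpha>(j := Suc (\<alpha> j))) f (\<theta> x))) +
      partial_deriv i (c \<alpha>) x * multi_D \<alpha> f (\<theta> x))" if f: "smooth f" for f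
  proof -
    have D: "smooth (\<lambda>x. multi_D \<alpha> f (\<theta> x))" for \<alpha>
      by (rule smooth_compose[OF smooth_multi_D[OF f] assms(2)])
    have "partial_deriv i (L f) = partial_deriv i
        (\<lambda>x. \<Sum>\<alpha> | mi_abs \<alpha> \<le> n. 1 * (c \<alpha> x * multi_D \<alpha> f (\<theta> x)))"
      by (simp add: L f)
    also have "\<dots> = (\<lambda>x. \<Sum>\<alpha> | mi_abs \<alpha> \<le> n.
        1 * partial_deriv i (\<lambda>x. c \<alpha> x * multi_D \<alpha> f (\<theta> x)) x)"
      by (rule partial_deriv_linear_combination) (intro smooth_mult c D)
    finally show ?thesis
      by (simp add: partial_deriv_mult c D partial_deriv_compose smooth_multi_D f assms(2)
          partial_deriv_multi_D)
  qed
  have "diff_op_along \<theta> (Suc n) (\<lambda>f x. \<Sum>\<alpha> | mi_abs \<alpha> \<le> n.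
      c \<alpha> x * (\<Sum>j\<in>UNIV. ?J x j * (\<i> * multi_D (\<alpha>(j := Suc (\<alpha> j))) f (\<theta> x))) +
      partial_deriv i (c \<alpha>) x * multi_D \<alpha> f (\<theta> x))"
    by (rule diff_op_along_sum) (use summand in auto)
  then show ?thesis by (rule diff_op_along_cong) (simp add: eq)
qed

lemma diff_op_along_partial_deriv_funpow:
  assumes "diff_op_along \<theta> n L" "smooth \<theta>"
  shows "diff_op_along \<theta> (m + n) (\<lambda>f. (partial_deriv i ^^ m) (L f))"
  by (induction m) (auto intro: assms diff_op_along_partial_deriv)

lemma diff_op_along_foldr_partial_deriv:
  assumes "diff_op_along \<theta> n L" "smooth \<theta>"
  shows "diff_op_along \<theta> (sum_list (map \<alpha> is) + n)
    (\<lambda>f. foldr (\<lambda>i. partial_deriv i ^^ \<alpha> i) is (L f))"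
proof (induction "is")
  case (Cons i js)
  show ?case
    using diff_op_along_partial_deriv_funpow[OF Cons assms(2), of "\<alpha> i" i]
    by (simp add: add.assoc)
qed (simp add: assms)

lemma diff_op_along_multi_D_comp:
  assumes "diff_op_along \<theta> n L" "smooth \<theta>"
  shows "diff_op_along \<theta> (mi_abs \<alpha> + n) (\<lambda>f. multi_D \<alpha> (L f))"
proof -
  have "diff_op_along \<theta> (mi_abs \<alpha> + n)
      (\<lambda>f x. inverse (\<i> ^ mi_abs \<alpha>) * foldr (\<lambda>i. partial_deriv i ^^ \<alpha> i) coords (L f) x)"
    unfolding mi_abs_coords[of \<alpha>]
    by (intro diff_op_along_mult diff_op_along_foldr_partial_deriv assms smooth_const)
  then show ?thesis
    by (simp add: multi_D_def[abs_def] multi_deriv_def field_simps)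
qed

text \<open>Substituting \<open>\<eta>\<close> changes the coefficients and the base map but not the
  order. This accounts for the outer operator evaluating at the inverse of its own
  diffeomorphism.\<close>

lemma diff_op_along_pullback:
  assumes "diff_op_along \<theta> n L" "smooth \<eta>"
  shows "diff_op_along (\<lambda>x. \<theta> (\<eta> x)) n (\<lambda>f x. L f (\<eta> x))"
proof -
  from assms obtain c where c: "\<And>\<alpha>. smooth (c \<alpha>)" and
    L: "\<And>f. smooth f \<Longrightarrow> L f = (\<lambda>x. \<Sum>\<alpha> | mi_abs \<alpha> \<le> n. c \<alpha> x * multi_D \<alpha> f (\<theta> x))"
    unfolding diff_op_along_def by auto
  then show ?thesis
    unfolding diff_op_along_def
    by (intro exI[of _ "\<lambda>\<alpha> x. c \<alpha> (\<eta> x)"]) (simp add: smooth_compose[OF c assms(2)])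
qed

section \<open>Symbols and their operators\<close>

text \<open>The part of \<open>Op1 P \<phi>\<close> of degree \<open>n\<close> in the formal
  parameter, acting on a single function. It turns \<open>Op1\<close> into a Cauchy product.\<close>

definition hbar_coeff ::
  "'d::finite symbol \<Rightarrow> (real^'d \<Rightarrow> real^'d) \<Rightarrow> nat \<Rightarrow>
     (real^'d \<Rightarrow> complex) \<Rightarrow> real^'d \<Rightarrow> complex" where
  "hbar_coeff P \<phi> n f =
     (\<lambda>x. \<Sum>\<alpha> | mi_abs \<alpha> \<le> n. P n \<alpha> x * multi_D \<alpha> f (inv_into UNIV \<phi> x))"

lemma Op1_nth: "fps_nth (Op1 P \<phi> \<psi>) N = (\<lambda>x. \<Sum>n\<le>N. hbar_coeff P \<phi> n (fps_nth \<psi> (N - n)) x)"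
  by (simp add: Op1_def hbar_coeff_def)

lemma diff_op_along_hbar_coeff:
  assumes "P \<in> symbols"
  shows "diff_op_along (inv_into UNIV \<phi>) n (hbar_coeff P \<phi> n)"
  using assms unfolding diff_op_along_def hbar_coeff_def symbols_def
  by (intro exI[of _ "P n"]) auto

lemma smooth_hbar_coeff:
  assumes "P \<in> symbols" "diffeomorphism \<phi>" "smooth f"
  shows "smooth (hbar_coeff P \<phi> n f)"
  using diff_op_along_smooth[OF diff_op_along_hbar_coeff[OF assms(1)] _ assms(3)] assms(2)
  by (simp add: diffeomorphism_def)

lemma hbar_coeff_linear_combination:
  assumes "P \<in> symbols" "\<And>i. i \<in> I \<Longrightarrow> smooth (f i)"
  shows "hbar_coeff P \<phi> n (\<lambda>x. \<Sum>i\<in>I. c i * f i x) = (\<lambda>x. \<Sum>i\<in>I. c i * hbar_coeff P \<phi> n (f i) x)"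
  by (rule diff_op_along_linear_combination[OF diff_op_along_hbar_coeff[OF assms(1)]])
     (rule assms(2))

lemma hbar_coeff_sum:
  assumes "P \<in> symbols" "\<And>i. i \<in> I \<Longrightarrow> smooth (f i)"
  shows "hbar_coeff P \<phi> n (\<lambda>x. \<Sum>i\<in>I. f i x) = (\<lambda>x. \<Sum>i\<in>I. hbar_coeff P \<phi> n (f i) x)"
  using hbar_coeff_linear_combination[OF assms, where c = "\<lambda>_. 1"] by simp

lemma hbar_coeff_add:
  assumes "P \<in> symbols" "smooth f" "smooth g"
  shows "hbar_coeff P \<phi> n (\<lambda>x. f x + g x) = (\<lambda>x. hbar_coeff P \<phi> n f x + hbar_coeff P \<phi> n g x)"
  \<comment> \<open>A binary sum is a sum indexed by \<open>bool\<close>.\<close>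
  using hbar_coeff_sum[OF assms(1), of "UNIV :: bool set" "\<lambda>b. if b then f else g"] assms(2,3)
  by (simp add: UNIV_bool add.commute)

lemma smooth_series_nth: "\<psi> \<in> smooth_series \<Longrightarrow> smooth (fps_nth \<psi> n)"
  by (simp add: smooth_series_def)

lemma Op1_smooth_series:
  assumes "P \<in> symbols" "diffeomorphism \<phi>" "\<psi> \<in> smooth_series"
  shows "Op1 P \<phi> \<psi> \<in> smooth_series"
proof -
  have "smooth (fps_nth (Op1 P \<phi> \<psi>) n)" for n
    unfolding Op1_nth by (intro smooth_sum smooth_hbar_coeff smooth_series_nth assms)
  then show ?thesis by (simp add: smooth_series_def)
qed

lemma series_linear_Op1:
  fixes P :: "'d::finite symbol"
  assumes P: "P \<in> symbols" and \<phi>: "diffeomorphism \<phi>"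
  shows "series_linear (Op1 P \<phi>)"
  unfolding series_linear_def
proof (intro conjI ballI allI)
  fix \<psi> :: "(real^'d \<Rightarrow> complex) fps"
  assume \<psi>: "\<psi> \<in> smooth_series"
  show "Op1 P \<phi> \<psi> \<in> smooth_series" by (rule Op1_smooth_series[OF P \<phi> \<psi>])
  show "Op1 P \<phi> (\<psi> + \<psi>') = Op1 P \<phi> \<psi> + Op1 P \<phi> \<psi>'" if \<psi>': "\<psi>' \<in> smooth_series" for \<psi>'
  proof (rule fps_ext)
    fix N
    show "fps_nth (Op1 P \<phi> (\<psi> + \<psi>')) N = fps_nth (Op1 P \<phi> \<psi> + Op1 P \<phi> \<psi>') N"
      using smooth_series_nth[OF \<psi>] smooth_series_nth[OF \<psi>']
      by (simp add: Op1_nth plus_fun_def hbar_coeff_add[OF P] sum.distrib)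
  qed
  show "Op1 P \<phi> (series_scale c \<psi>) = series_scale c (Op1 P \<phi> \<psi>)" for c
  proof (rule fps_ext, rule ext)
    fix N x
    define F where "F n k = fps_nth c k * hbar_coeff P \<phi> n (fps_nth \<psi> (N - n - k)) x" for n k
    have "fps_nth (Op1 P \<phi> (series_scale c \<psi>)) N x = (\<Sum>n\<le>N. \<Sum>k\<le>N - n. F n k)"
      using smooth_series_nth[OF \<psi>]
      by (simp add: Op1_nth series_scale_def hbar_coeff_linear_combination[OF P] F_def)
    \<comment> \<open>The triangle \<open>n + k \<le> N\<close> is written as a restricted square so
      that the order of summation can be exchanged.\<close>
    also have "\<dots> = (\<Sum>n\<le>N. \<Sum>k | k \<in> {..N} \<and> n + k \<le> N. F n k)"
      by (intro sum.cong refl) auto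
    also have "\<dots> = (\<Sum>k\<le>N. \<Sum>n | n \<in> {..N} \<and> n + k \<le> N. F n k)"
      by (rule sum.swap_restrict) auto
    also have "\<dots> = (\<Sum>k\<le>N. \<Sum>n\<le>N - k. F n k)"
      by (intro sum.cong refl) auto
    also have "\<dots> = fps_nth (series_scale c (Op1 P \<phi> \<psi>)) N x"
      by (simp add: Op1_nth series_scale_def F_def sum_distrib_left add.commute)
    finally show "fps_nth (Op1 P \<phi> (series_scale c \<psi>)) N x =
      fps_nth (series_scale c (Op1 P \<phi> \<psi>)) N x" .
  qed
qed

lemma symbol_one_in_symbols: "symbol_one \<in> symbols"
  by (auto simp: symbols_def symbol_one_def smooth_const fun_eq_iff mi_abs_def)

lemma Op1_symbol_one: "Op1 symbol_one id \<psi> = \<psi>"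
proof (rule fps_ext, rule ext)
  fix N x
  have "hbar_coeff symbol_one id n f x = (if n = 0 then f x else 0)" for n and f :: "real^'a \<Rightarrow> complex"
  proof -
    have "hbar_coeff symbol_one id n f x =
        (\<Sum>\<alpha> :: 'a \<Rightarrow> nat | mi_abs \<alpha> \<le> n. if \<alpha> = (\<lambda>i. 0) then if n = 0 then f x else 0 else 0)"
      unfolding hbar_coeff_def by (intro sum.cong) (auto simp: symbol_one_def multi_D_0)
    moreover have "mi_abs (\<lambda>i::'a. 0) = 0" by (simp add: mi_abs_def)
    ultimately show ?thesis by (simp add: finite_mi_abs_le)
  qed
  then have "fps_nth (Op1 symbol_one id \<psi>) N x = (\<Sum>n\<le>N. if n = 0 then fps_nth \<psi> (N - n) x else 0)"
    by (simp add: Op1_nth)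
  then show "fps_nth (Op1 symbol_one id \<psi>) N x = fps_nth \<psi> N x" by simp
qed

text \<open>The test series is a monomial centred at \<open>y\<close>, the preimage of
  \<open>x\<close>, and constant in the formal parameter. The coefficient of degree \<open>N\<close>
  of its image at \<open>x\<close> is then a nonzero multiple of the single symbol coefficient at
  \<open>N\<close> and \<open>\<alpha>\<close>.\<close>

lemma symbol_eqI:
  fixes S S' :: "'d::finite symbol"
  assumes S: "S \<in> symbols" and S': "S' \<in> symbols" and \<phi>: "bij \<phi>"
    and eq: "\<And>\<psi>. \<psi> \<in> smooth_series \<Longrightarrow> Op1 S \<phi> \<psi> = Op1 S' \<phi> \<psi>"
  shows "S = S'"
proof (intro ext)
  fix N \<alpha> x
  define y where "y = inv_into UNIV \<phi> x"
  define f where "f = monomial_at 1 y \<alpha>"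
  have f: "smooth f" unfolding f_def by (rule smooth_monomial_at)
  have "fps_const f \<in> smooth_series"
    using f by (auto simp: smooth_series_def zero_fun_def smooth_const)
  from arg_cong[OF eq[OF this], of "\<lambda>\<psi>. fps_nth \<psi> N x"]
  have "(\<Sum>n\<le>N. hbar_coeff S \<phi> n (if N - n = 0 then f else 0) x) =
      (\<Sum>n\<le>N. hbar_coeff S' \<phi> n (if N - n = 0 then f else 0) x)"
    by (simp add: Op1_nth)
  moreover have "(\<Sum>n\<le>N. hbar_coeff R \<phi> n (if N - n = 0 then f else 0) x) =
      (if mi_abs \<alpha> \<le> N then R N \<alpha> x * multi_D \<alpha> f y else 0)"
    if R: "R \<in> symbols" for R
  proof -
    have zero: "hbar_coeff R \<phi> n 0 = (\<lambda>x. 0)" for n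
      \<comment> \<open>The zero function is the empty sum.\<close>
      using hbar_coeff_sum[OF R, of "{}"] by (simp add: zero_fun_def)
    have "(\<Sum>n\<le>N. hbar_coeff R \<phi> n (if N - n = 0 then f else 0) x) =
        (\<Sum>n\<le>N. if n = N then hbar_coeff R \<phi> N f x else 0)"
      by (intro sum.cong) (auto simp: zero)
    also have "\<dots> = hbar_coeff R \<phi> N f x" by simp
    also have "\<dots> = (\<Sum>\<beta> | mi_abs \<beta> \<le> N. if \<beta> = \<alpha> then R N \<alpha> x * multi_D \<alpha> f y else 0)"
      unfolding hbar_coeff_def y_def[symmetric]
      by (intro sum.cong) (auto simp: f_def multi_D_monomial_at_eq_0_iff)
    finally show ?thesis by (simp add: finite_mi_abs_le)
  qed
  ultimately have "mi_abs \<alpha> \<le> N \<Longrightarrow> S N \<alpha> x = S' N \<alpha> x"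
    using S S' multi_D_monomial_at_eq_0_iff[of \<alpha> y \<alpha>] by (simp add: f_def)
  \<comment> \<open>Above the order bound no test is made: both coefficients vanish by definition of
    \<open>symbols\<close>.\<close>
  moreover have "N < mi_abs \<alpha> \<Longrightarrow> S N \<alpha> x = S' N \<alpha> x"
    using S S' by (simp add: symbols_def)
  ultimately show "S N \<alpha> x = S' N \<alpha> x" by linarith
qed

section \<open>Existence and uniqueness of the star product\<close>

text \<open>The outer operator differentiates at most \<open>n\<close> times an operator of order
  \<open>m\<close>, so orders add. The base maps compose to the inverse of
  \<open>\<phi>\<^sub>1 \<circ> \<phi>\<^sub>2\<close>.\<close>

lemma diff_op_along_comp_hbar_coeff:
  assumes P: "P \<in> symbols" and K: "K \<in> symbols"
    and \<phi>\<^sub>1: "diffeomorphism \<phi>\<^sub>1" and \<phi>\<^sub>2: "diffeomorphism \<phi>\<^sub>2"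
  shows "diff_op_along (inv_into UNIV (\<phi>\<^sub>1 \<circ> \<phi>\<^sub>2)) (n + m) (\<lambda>f. hbar_coeff P \<phi>\<^sub>1 n (hbar_coeff K \<phi>\<^sub>2 m f))"
proof -
  have inv: "inv_into UNIV (\<phi>\<^sub>1 \<circ> \<phi>\<^sub>2) = (\<lambda>x. inv_into UNIV \<phi>\<^sub>2 (inv_into UNIV \<phi>\<^sub>1 x))"
    using o_inv_distrib[of \<phi>\<^sub>1 \<phi>\<^sub>2] \<phi>\<^sub>1 \<phi>\<^sub>2 by (auto simp: diffeomorphism_def o_def)
  have sm: "smooth (inv_into UNIV \<phi>\<^sub>1)" "smooth (inv_into UNIV \<phi>\<^sub>2)" "\<And>\<alpha>. smooth (P n \<alpha>)"
    using \<phi>\<^sub>1 \<phi>\<^sub>2 P by (auto simp: diffeomorphism_def symbols_def)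
  have "diff_op_along (\<lambda>x. inv_into UNIV \<phi>\<^sub>2 (inv_into UNIV \<phi>\<^sub>1 x)) (n + m)
      (\<lambda>f x. \<Sum>\<alpha> | mi_abs \<alpha> \<le> n. P n \<alpha> x * multi_D \<alpha> (hbar_coeff K \<phi>\<^sub>2 m f) (inv_into UNIV \<phi>\<^sub>1 x))"
  proof (intro diff_op_along_sum diff_op_along_mult sm)
    fix \<alpha> :: "'a \<Rightarrow> nat" assume "\<alpha> \<in> {\<alpha>. mi_abs \<alpha> \<le> n}"
    then show "diff_op_along (\<lambda>x. inv_into UNIV \<phi>\<^sub>2 (inv_into UNIV \<phi>\<^sub>1 x)) (n + m)
      (\<lambda>f x. multi_D \<alpha> (hbar_coeff K \<phi>\<^sub>2 m f) (inv_into UNIV \<phi>\<^sub>1 x))"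
      by (intro diff_op_along_mono[OF diff_op_along_pullback[OF diff_op_along_multi_D_comp[OF
                diff_op_along_hbar_coeff[OF K] sm(2)] sm(1)]]) auto
  qed
  then show ?thesis unfolding inv hbar_coeff_def[of P] .
qed

text \<open>The terms are regrouped by the total degree \<open>k = n + m\<close>, which is the
  degree that bounds the order of the composite.\<close>

lemma Op1_comp_nth:
  assumes P: "P \<in> symbols" and K: "K \<in> symbols"
    and \<phi>\<^sub>2: "diffeomorphism \<phi>\<^sub>2" and \<psi>: "\<psi> \<in> smooth_series"
  shows "fps_nth (Op1 P \<phi>\<^sub>1 (Op1 K \<phi>\<^sub>2 \<psi>)) N x =
    (\<Sum>k\<le>N. \<Sum>n\<le>k. hbar_coeff P \<phi>\<^sub>1 n (hbar_coeff K \<phi>\<^sub>2 (k - n) (fps_nth \<psi> (N - k))) x)"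
proof -
  define F where "F n m = hbar_coeff P \<phi>\<^sub>1 n (hbar_coeff K \<phi>\<^sub>2 m (fps_nth \<psi> (N - (n + m)))) x" for n m
  have "fps_nth (Op1 P \<phi>\<^sub>1 (Op1 K \<phi>\<^sub>2 \<psi>)) N x = (\<Sum>n\<le>N. \<Sum>m\<le>N - n. F n m)"
    using smooth_series_nth[OF \<psi>]
    by (simp add: Op1_nth hbar_coeff_sum[OF P] smooth_hbar_coeff[OF K \<phi>\<^sub>2] F_def)
  also have "\<dots> = (\<Sum>(n, m) | n + m \<le> N. F n m)"
    by (subst sum.Sigma) (auto intro!: sum.cong)
  also have "\<dots> = (\<Sum>k\<le>N. \<Sum>n\<le>k. F n (k - n))"
    by (rule sum.triangle_reindex_eq)
  finally show ?thesis by (simp add: F_def)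
qed

lemma symbol_star_exists:
  fixes P K :: "'d::finite symbol"
  assumes P: "P \<in> symbols" and K: "K \<in> symbols"
    and \<phi>\<^sub>1: "diffeomorphism \<phi>\<^sub>1" and \<phi>\<^sub>2: "diffeomorphism \<phi>\<^sub>2"
  shows "\<exists>S\<in>symbols. \<forall>\<psi>\<in>smooth_series. Op1 P \<phi>\<^sub>1 (Op1 K \<phi>\<^sub>2 \<psi>) = Op1 S (\<phi>\<^sub>1 \<circ> \<phi>\<^sub>2) \<psi>"
proof -
  let ?L = "\<lambda>k f x. \<Sum>n\<le>k. hbar_coeff P \<phi>\<^sub>1 n (hbar_coeff K \<phi>\<^sub>2 (k - n) f) x"
  have "diff_op_along (inv_into UNIV (\<phi>\<^sub>1 \<circ> \<phi>\<^sub>2)) k (?L k)" for k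
  proof (rule diff_op_along_sum)
    fix n assume "n \<in> {..k}"
    then show "diff_op_along (inv_into UNIV (\<phi>\<^sub>1 \<circ> \<phi>\<^sub>2)) k
        (\<lambda>f. hbar_coeff P \<phi>\<^sub>1 n (hbar_coeff K \<phi>\<^sub>2 (k - n) f))"
      using diff_op_along_comp_hbar_coeff[OF P K \<phi>\<^sub>1 \<phi>\<^sub>2, of n "k - n"] by simp
  qed
  \<comment> \<open>Naming the property keeps the choice of one coefficient family for each
    \<open>k\<close> a plain first-order step.\<close>
  moreover define spec where "spec k c \<longleftrightarrow> (\<forall>\<alpha>. smooth (c \<alpha>)) \<and> (\<forall>f. smooth f \<longrightarrow> ?L k f =
      (\<lambda>x. \<Sum>\<alpha> | mi_abs \<alpha> \<le> k. c \<alpha> x * multi_D \<alpha> f (inv_into UNIV (\<phi>\<^sub>1 \<circ> \<phi>\<^sub>2) x)))" for k c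
  ultimately have "\<forall>k. \<exists>c. spec k c"
    unfolding diff_op_along_def by simp
  then obtain c where spec: "\<And>k. spec k (c k)" by metis
  then have c: "\<And>k \<alpha>. smooth (c k \<alpha>)"
    and L: "\<And>k f. smooth f \<Longrightarrow> ?L k f =
      (\<lambda>x. \<Sum>\<alpha> | mi_abs \<alpha> \<le> k. c k \<alpha> x * multi_D \<alpha> f (inv_into UNIV (\<phi>\<^sub>1 \<circ> \<phi>\<^sub>2) x))"
    by (simp_all add: spec_def)
  \<comment> \<open>The chosen coefficients are arbitrary above order \<open>k\<close>. Setting them
    to zero there yields a symbol and leaves the operator unchanged.\<close>
  define S where "S k \<alpha> = (if mi_abs \<alpha> \<le> k then c k \<alpha> else (\<lambda>x. 0))" for k and \<alpha> :: "'d \<Rightarrow> nat"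
  have "S \<in> symbols" using c by (auto simp: symbols_def S_def smooth_const)
  moreover have "?L k f = hbar_coeff S (\<phi>\<^sub>1 \<circ> \<phi>\<^sub>2) k f" if "smooth f" for k f
    using L[OF that, of k] by (simp add: hbar_coeff_def S_def)
  then have "Op1 P \<phi>\<^sub>1 (Op1 K \<phi>\<^sub>2 \<psi>) = Op1 S (\<phi>\<^sub>1 \<circ> \<phi>\<^sub>2) \<psi>" if "\<psi> \<in> smooth_series" for \<psi>
    unfolding fps_eq_iff fun_eq_iff Op1_comp_nth[OF P K \<phi>\<^sub>2 that]
    by (simp add: Op1_nth fun_eq_iff smooth_series_nth[OF that])
  ultimately show ?thesis by blast
qed

lemma bij_comp_diffeomorphism: "diffeomorphism \<phi>\<^sub>1 \<Longrightarrow> diffeomorphism \<phi>\<^sub>2 \<Longrightarrow> bij (\<phi>\<^sub>1 \<circ> \<phi>\<^sub>2)"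
  by (simp add: diffeomorphism_def bij_comp)

text \<open>Existence and uniqueness discharge the definite description. Later arguments compare
  operators instead of unfolding it.\<close>

lemma symbol_star_eq_iff:
  assumes P: "P \<in> symbols" and K: "K \<in> symbols"
    and \<phi>\<^sub>1: "diffeomorphism \<phi>\<^sub>1" and \<phi>\<^sub>2: "diffeomorphism \<phi>\<^sub>2" and R: "R \<in> symbols"
  shows "symbol_star \<phi>\<^sub>1 \<phi>\<^sub>2 P K = R \<longleftrightarrow>
    (\<forall>\<psi>\<in>smooth_series. Op1 P \<phi>\<^sub>1 (Op1 K \<phi>\<^sub>2 \<psi>) = Op1 R (\<phi>\<^sub>1 \<circ> \<phi>\<^sub>2) \<psi>)"
proof -
  let ?spec = "\<lambda>S. S \<in> symbols \<and>
    (\<forall>\<psi>\<in>smooth_series. Op1 P \<phi>\<^sub>1 (Op1 K \<phi>\<^sub>2 \<psi>) = Op1 S (\<phi>\<^sub>1 \<circ> \<phi>\<^sub>2) \<psi>)"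
  have unique: "S = S'" if "?spec S" "?spec S'" for S S'
    using that by (intro symbol_eqI[OF _ _ bij_comp_diffeomorphism[OF \<phi>\<^sub>1 \<phi>\<^sub>2]]) auto
  obtain S where S: "?spec S"
    using symbol_star_exists[OF P K \<phi>\<^sub>1 \<phi>\<^sub>2] by auto
  have "symbol_star \<phi>\<^sub>1 \<phi>\<^sub>2 P K = S"
    unfolding symbol_star_def using S unique by (intro the_equality) blast+
  then show ?thesis using S R unique by blast
qed

lemma symbol_star_in_symbols:
  assumes "P \<in> symbols" "K \<in> symbols" "diffeomorphism \<phi>\<^sub>1" "diffeomorphism \<phi>\<^sub>2"
  shows "symbol_star \<phi>\<^sub>1 \<phi>\<^sub>2 P K \<in> symbols"
proof -
  obtain S where "S \<in> symbols"
    "\<forall>\<psi>\<in>smooth_series. Op1 P \<phi>\<^sub>1 (Op1 K \<phi>\<^sub>2 \<psi>) = Op1 S (\<phi>\<^sub>1 \<circ> \<phi>\<^sub>2) \<psi>"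
    using symbol_star_exists[OF assms] by auto
  then show ?thesis using symbol_star_eq_iff[OF assms, of S] by simp
qed

lemma Op1_symbol_star:
  assumes "P \<in> symbols" "K \<in> symbols" "diffeomorphism \<phi>\<^sub>1" "diffeomorphism \<phi>\<^sub>2" "\<psi> \<in> smooth_series"
  shows "Op1 (symbol_star \<phi>\<^sub>1 \<phi>\<^sub>2 P K) (\<phi>\<^sub>1 \<circ> \<phi>\<^sub>2) \<psi> = Op1 P \<phi>\<^sub>1 (Op1 K \<phi>\<^sub>2 \<psi>)"
  using symbol_star_eq_iff[OF assms(1-4) symbol_star_in_symbols[OF assms(1-4)]] assms(5) by simp

section \<open>Amplitudes and systems\<close>

lemma mem_tuples_1_iff: "gs \<in> tuples G 1 \<longleftrightarrow> (\<exists>g\<in>carrier G. gs = [g])"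
  by (auto simp: tuples_def length_Suc_conv)

lemma mem_tuples_2_iff: "gs \<in> tuples G 2 \<longleftrightarrow> (\<exists>g\<in>carrier G. \<exists>h\<in>carrier G. gs = [g, h])"
  by (auto simp: tuples_def length_Suc_conv numeral_2_eq_2)

lemma cochains_0_Nil: "u \<in> cochains G 0 \<Longrightarrow> u [] \<in> symbols"
  unfolding cochains_def by (erule PiE_mem) (simp add: tuples_def)

lemma cochains_1_iff:
  "a \<in> cochains G 1 \<longleftrightarrow> a \<in> extensional (tuples G 1) \<and> (\<forall>g\<in>carrier G. a [g] \<in> symbols)"
  by (auto simp: cochains_def PiE_def Pi_def mem_tuples_1_iff simp del: One_nat_def)

section \<open>Maurer-Cartan elements, representations and gauge equivalence\<close>

locale group_action_on_space = group G
  for G :: "('g, 'm) monoid_scheme" (structure) +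
  fixes \<phi> :: "'g \<Rightarrow> real^'d::finite \<Rightarrow> real^'d"
  assumes action: "smooth_action G \<phi>"
begin

lemma diffeomorphism_action: "g \<in> carrier G \<Longrightarrow> diffeomorphism (\<phi> g)"
  and action_mult: "g \<in> carrier G \<Longrightarrow> h \<in> carrier G \<Longrightarrow> \<phi> g \<circ> \<phi> h = \<phi> (g \<otimes> h)"
  and action_one: "\<phi> \<one> = id"
  using action by (auto simp: smooth_action_def)

lemma diffeomorphism_id: "diffeomorphism (id :: real^'d \<Rightarrow> real^'d)"
  using diffeomorphism_action[of \<one>] by (simp add: action_one)

text \<open>For a 1-cochain the differential has the single term \<open>i = 1\<close> with sign -1,
  so it sends \<open>[g, h]\<close> to \<open>- a [g \<otimes> h]\<close>.\<close>

lemma maurer_cartan_iff_symbol_star: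
  assumes a: "a \<in> cochains G 1"
  shows "a \<in> maurer_cartan G \<phi> \<longleftrightarrow>
    (\<forall>g\<in>carrier G. \<forall>h\<in>carrier G. symbol_star (\<phi> g) (\<phi> h) (a [g]) (a [h]) = a [g \<otimes> h])"
proof -
  have "cochain_d G 1 a [g, h] + cochain_star G \<phi> 1 1 a a [g, h] = 0 \<longleftrightarrow>
      symbol_star (\<phi> g) (\<phi> h) (a [g]) (a [h]) = a [g \<otimes> h]"
    if "g \<in> carrier G" "h \<in> carrier G" for g h
  proof -
    have "[g, h] \<in> tuples G 2" using that by (auto simp: mem_tuples_2_iff)
    then have "cochain_d G 1 a [g, h] = - a [g \<otimes> h]"
        "cochain_star G \<phi> 1 1 a a [g, h] = symbol_star (\<phi> g) (\<phi> h) (a [g]) (a [h])"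
      using that
      by (auto simp: cochain_d_def cochain_star_def merge_at_def list_mult_def numeral_2_eq_2 fun_eq_iff)
    then show ?thesis by (simp add: add_eq_0_iff)
  qed
  then show ?thesis using a by (auto simp: maurer_cartan_def mem_tuples_2_iff)
qed

text \<open>Since a symbol is determined by its operator, the multiplicative law for symbols is the
  one for operators, and the normalization says that the unit acts as the identity. Linearity holds
  for every \<open>Op1\<close>.\<close>

lemma normalized_maurer_cartan_iff_representation:
  assumes a: "a \<in> cochains G 1"
  shows "a \<in> normalized_maurer_cartan G \<phi> \<longleftrightarrow> representation G (system_op \<phi> (system_of G a))"
proof -
  have sym: "a [g] \<in> symbols" if "g \<in> carrier G" for g
    using a that unfolding cochains_1_iff by blast
  have op: "system_op \<phi> (system_of G a) g = Op1 (a [g]) (\<phi> g)" if "g \<in> carrier G" for g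
    using that by (simp add: system_op_def system_of_def)
  have mult: "symbol_star (\<phi> g) (\<phi> h) (a [g]) (a [h]) = a [g \<otimes> h] \<longleftrightarrow>
      (\<forall>\<psi>\<in>smooth_series. Op1 (a [g \<otimes> h]) (\<phi> (g \<otimes> h)) \<psi> = Op1 (a [g]) (\<phi> g) (Op1 (a [h]) (\<phi> h) \<psi>))"
    if "g \<in> carrier G" "h \<in> carrier G" for g h
    using that by (subst symbol_star_eq_iff) (auto simp: sym diffeomorphism_action action_mult)
  have one: "a [\<one>] = symbol_one \<longleftrightarrow> (\<forall>\<psi>\<in>smooth_series. Op1 (a [\<one>]) (\<phi> \<one>) \<psi> = \<psi>)"
    using symbol_eqI[OF sym[OF one_closed] symbol_one_in_symbols bij_id]
    by (auto simp: action_one Op1_symbol_one)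
  have "series_linear (Op1 (a [g]) (\<phi> g))" if "g \<in> carrier G" for g
    by (rule series_linear_Op1[OF sym[OF that] diffeomorphism_action[OF that]])
  then show ?thesis
    unfolding normalized_maurer_cartan_def representation_def
    by (simp add: maurer_cartan_iff_symbol_star[OF a] mult one op cong: ball_cong)
qed

text \<open>The inverse evaluates at the head of a one-element list. Extensionality on both sides
  fixes the values elsewhere.\<close>

lemma bij_betw_system_of:
  "bij_betw (system_of G) (cochains G 1 :: ('g list \<Rightarrow> 'd symbol) set) (carrier G \<rightarrow>\<^sub>E symbols)"
proof (rule bij_betw_byWitness[where f' = "\<lambda>a. \<lambda>gs\<in>tuples G 1. a (hd gs)"])
  show "\<forall>a\<in>cochains G 1. (\<lambda>gs\<in>tuples G 1. system_of G a (hd gs)) = (a :: 'g list \<Rightarrow> 'd symbol)"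
    by (auto simp: cochains_1_iff system_of_def mem_tuples_1_iff fun_eq_iff extensional_def restrict_def
        simp del: One_nat_def)
  show "\<forall>a\<in>carrier G \<rightarrow>\<^sub>E symbols. system_of G (\<lambda>gs\<in>tuples G 1. a (hd gs)) = (a :: 'g \<Rightarrow> 'd symbol)"
    by (auto simp: system_of_def tuples_def fun_eq_iff PiE_def extensional_def)
  show "system_of G ` cochains G 1 \<subseteq> carrier G \<rightarrow>\<^sub>E (symbols :: 'd symbol set)"
    by (auto simp: cochains_1_iff system_of_def simp del: One_nat_def)
  show "(\<lambda>a. \<lambda>gs\<in>tuples G 1. a (hd gs)) ` (carrier G \<rightarrow>\<^sub>E (symbols :: 'd symbol set)) \<subseteq> cochains G 1"
    by (auto simp: cochains_1_iff mem_tuples_1_iff simp del: One_nat_def)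
qed

lemma bij_betw_normalized_maurer_cartan:
  "bij_betw (system_of G) (normalized_maurer_cartan G \<phi>) (formal_systems G \<phi>)"
proof -
  have sub: "normalized_maurer_cartan G \<phi> =
      {a \<in> cochains G 1. representation G (system_op \<phi> (system_of G a))}"
    using normalized_maurer_cartan_iff_representation
    by (auto simp: normalized_maurer_cartan_def maurer_cartan_def)
  \<comment> \<open>Every extensional map into \<open>symbols\<close> comes from a 1-cochain, and
    for a formal system that cochain satisfies the condition in \<open>sub\<close>.\<close>
  have "formal_systems G \<phi> = system_of G ` normalized_maurer_cartan G \<phi>"
    unfolding sub formal_systems_def bij_betw_imp_surj_on[OF bij_betw_system_of, symmetric] by blast
  then show ?thesis
    using bij_betw_imp_inj_on[OF bij_betw_system_of] sub
    by (auto simp: bij_betw_def intro: inj_on_subset)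
qed

text \<open>The empty product is the unit, which acts as \<open>id\<close>. So the star product of
  0-cochains is composition of operators along \<open>id\<close>, and the inverse cochain gives the
  inverse operator.\<close>

lemma series_invertible_Op1:
  assumes "cochain_invertible G \<phi> u"
  shows "series_invertible (Op1 (u []) id)"
proof -
  from assms obtain v where mem: "u \<in> cochains G 0" "v \<in> cochains G 0"
    and uv: "cochain_star G \<phi> 0 0 u v = cochain_one G"
    and vu: "cochain_star G \<phi> 0 0 v u = cochain_one G"
    unfolding cochain_invertible_def by (elim conjE bexE)
  have u: "u [] \<in> symbols" and v: "v [] \<in> symbols"
    using mem by (simp_all only: cochains_0_Nil)
  have "symbol_star id id (u []) (v []) = symbol_one" "symbol_star id id (v []) (u []) = symbol_one"
    using uv[THEN fun_cong, of "[]"] vu[THEN fun_cong, of "[]"]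
    by (simp_all add: cochain_star_def cochain_one_def tuples_def list_mult_def action_one)
  then have "Op1 (u []) id (Op1 (v []) id \<psi>) = \<psi> \<and> Op1 (v []) id (Op1 (u []) id \<psi>) = \<psi>"
    if "\<psi> \<in> smooth_series" for \<psi>
    using Op1_symbol_star[OF u v diffeomorphism_id diffeomorphism_id that]
      Op1_symbol_star[OF v u diffeomorphism_id diffeomorphism_id that]
    by (simp add: Op1_symbol_one)
  then show ?thesis
    unfolding series_invertible_def
    using series_linear_Op1[OF u diffeomorphism_id] series_linear_Op1[OF v diffeomorphism_id] by blast
qed

lemma gauge_equivalent_imp_equivalent_representations:
  assumes a: "a \<in> normalized_maurer_cartan G \<phi>" and b: "b \<in> normalized_maurer_cartan G \<phi>"
    and ab: "gauge_equivalent G \<phi> a b"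
  shows "equivalent_representations G (system_op \<phi> (system_of G a)) (system_op \<phi> (system_of G b))"
proof -
  from ab obtain u where inv: "cochain_invertible G \<phi> u" and
    gauge: "\<forall>gs\<in>tuples G 1.
      cochain_star G \<phi> 1 0 a u gs - cochain_star G \<phi> 0 1 u b gs = cochain_d G 0 u gs"
    unfolding gauge_equivalent_def by (elim exE conjE)
  have cochains: "a \<in> cochains G 1" "b \<in> cochains G 1"
    using a b by (auto simp: normalized_maurer_cartan_def maurer_cartan_def)
  have u: "u [] \<in> symbols"
    using inv unfolding cochain_invertible_def by (elim conjE) (rule cochains_0_Nil)
  have "Op1 (a [g]) (\<phi> g) (Op1 (u []) id \<psi>) = Op1 (u []) id (Op1 (b [g]) (\<phi> g) \<psi>)"
    if g: "g \<in> carrier G" and \<psi>: "\<psi> \<in> smooth_series" for g \<psi>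
  proof -
    have sym: "a [g] \<in> symbols" "b [g] \<in> symbols"
      using cochains g unfolding cochains_1_iff by blast+
    \<comment> \<open>The right-hand side is zero because the differential of a 0-cochain is an
      empty sum.\<close>
    have "symbol_star (\<phi> g) id (a [g]) (u []) - symbol_star id (\<phi> g) (u []) (b [g]) = 0"
      using bspec[OF gauge, of "[g]"] g
      by (simp add: cochain_star_def cochain_d_def tuples_def list_mult_def action_one zero_fun_def)
    \<comment> \<open>Both \<open>\<phi> g \<circ> id\<close> and \<open>id \<circ> \<phi> g\<close>
      equal \<open>\<phi> g\<close>, so equal symbols give equal operators along the same
      map.\<close>
    then show ?thesis
      using Op1_symbol_star[OF sym(1) u diffeomorphism_action[OF g] diffeomorphism_id \<psi>]
        Op1_symbol_star[OF u sym(2) diffeomorphism_id diffeomorphism_action[OF g] \<psi>]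
      by simp
  qed
  then have "\<forall>g\<in>carrier G. \<forall>\<psi>\<in>smooth_series. system_op \<phi> (system_of G a) g (Op1 (u []) id \<psi>) =
      Op1 (u []) id (system_op \<phi> (system_of G b) g \<psi>)"
    by (simp add: system_op_def system_of_def)
  then show ?thesis
    unfolding equivalent_representations_def
    using series_invertible_Op1[OF inv] a b
      normalized_maurer_cartan_iff_representation[OF cochains(1)]
      normalized_maurer_cartan_iff_representation[OF cochains(2)] by blast
qed

end

theorem proposition21:
  fixes G :: "('g, 'm) monoid_scheme"
    and \<phi> :: "'g \<Rightarrow> real^'d::finite \<Rightarrow> real^'d"
  assumes "group G"
    and "smooth_action G \<phi>"
  shows "bij_betw (system_of G) (normalized_maurer_cartan G \<phi>) (formal_systems G \<phi>) \<and>
    (\<forall>a\<in>normalized_maurer_cartan G \<phi>. \<forall>b\<in>normalized_maurer_cartan G \<phi>.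
       gauge_equivalent G \<phi> a b \<longrightarrow>
       equivalent_representations G
         (system_op \<phi> (system_of G a)) (system_op \<phi> (system_of G b)))"
proof -
  interpret group_action_on_space G \<phi>
    using assms by (simp add: group_action_on_space_def group_action_on_space_axioms_def)
  show ?thesis
    using bij_betw_normalized_maurer_cartan gauge_equivalent_imp_equivalent_representations by blast
qed

end
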